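(* For every real $\varepsilon > 0$, there exists $q_0$ such that for all integers $q\ge q_0$ the following holds: If $G$ is a bipartite simple graph that is properly edge colored with $(1+\varepsilon)q$ colors, with at least $(1+\varepsilon)qr$ edges for some integer $r\le q$, and such that no color appears on more than $q$ edges, then $G$ has a rainbow matching of size $r$.
   Context: A proper edge coloring assigns colors to edges so that edges sharing a vertex get different colors. A matching is rainbow if its edges have pairwise distinct colors. *)

theory Defs
  imports Complex_Main
begin

definition simple_graph :: "'v set \<Rightarrow> 'v set set \<Rightarrow> bool" where
  "simple_graph V E \<longleftrightarrow> finite V \<and> (\<forall>e\<in>E. e \<subseteq> V \<and> card e = 2)"

definition bipartite :: "'v set \<Rightarrow> 'v set set \<Rightarrow> bool" where
  "bipartite V E \<longleftrightarrow>
    (\<exists>A B. A \<union> B = V \<and> A \<inter> B = {} \<and> (\<forall>e\<in>E. \<exists>a\<in>A. \<exists>b\<in>B. e = {a, b}))"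

text \<open>\<open>C\<close> is the palette of available colors; a coloring need not use all of them.\<close>

definition proper_edge_coloring :: "'v set set \<Rightarrow> 'c set \<Rightarrow> ('v set \<Rightarrow> 'c) \<Rightarrow> bool" where
  "proper_edge_coloring E C c \<longleftrightarrow>
    c ` E \<subseteq> C \<and> (\<forall>e\<in>E. \<forall>f\<in>E. e \<noteq> f \<and> e \<inter> f \<noteq> {} \<longrightarrow> c e \<noteq> c f)"

definition matching :: "'v set set \<Rightarrow> 'v set set \<Rightarrow> bool" where
  "matching E M \<longleftrightarrow> M \<subseteq> E \<and> pairwise disjnt M"

definition rainbow :: "('v set \<Rightarrow> 'c) \<Rightarrow> 'v set set \<Rightarrow> bool" where
  "rainbow c M \<longleftrightarrow> inj_on c M"

end

theory Submission
  imports Defs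
begin

text \<open>
  Give every edge \<open>{a, b}\<close> of colour \<open>x\<close> the three vertices \<open>a\<close>, \<open>b\<close>, \<open>x\<close>. Properness makes this a linear
  3-uniform hypergraph of maximum degree at most \<open>\<Delta> = (1 + \<epsilon>) * q\<close>, whose matchings are the rainbow matchings.

  Nibble: with edge weights at most \<open>1 / D\<close>, \<open>D\<close> large, every fractional matching can be rounded to a
  matching of almost the same size. Picking each edge \<open>e\<close> independently with probability \<open>\<theta> * w e\<close> and reweighting
  the edges that survive shows in expectation that a guaranteed ratio \<open>\<rho>\<close> improves to
  \<open>\<rho> + \<theta> * (1 - \<rho>) - 5 * \<theta>\<^sup>2\<close>, so ratios arbitrarily close to 1 are reached.

  The weight \<open>1 / \<Delta>\<close> on all edges has size at least \<open>r\<close>. Call a vertex full if its degree exceeds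
  \<open>(1 - \<gamma>) * \<Delta>\<close>. Since \<open>r \<le> q\<close>, either there are many more than \<open>\<Delta> * r\<close> edges, or every full vertex has many edges
  without a second full vertex. In the latter case, if many edges contain no full vertex, or many contain
  two, the weights can be shifted so as to exceed \<open>r\<close> by a constant factor, which absorbs the loss of the nibble.
  Otherwise almost all edges have exactly one full vertex. Then a small random set of vertices and colours is reserved,
  the nibble on the rest covers almost everything needed, and the few missing full vertices are matched greedily
  inside the reserve.
\<close>

subsection \<open>Random subsets\<close>

text \<open>The law of a random subset of \<open>U\<close> that contains each \<open>i\<close>
  independently with probability \<open>p i\<close>. On a finite ground set every expectation is a
  finite sum, which is all the probability used below.\<close>

definition subset_weight :: "'a set \<Rightarrow> ('a \<Rightarrow> real) \<Rightarrow> 'a set \<Rightarrow> real" where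
  "subset_weight U p X = (\<Prod>i\<in>X. p i) * (\<Prod>i\<in>U - X. 1 - p i)"

definition subset_expectation :: "'a set \<Rightarrow> ('a \<Rightarrow> real) \<Rightarrow> ('a set \<Rightarrow> real) \<Rightarrow> real" where
  "subset_expectation U p f = (\<Sum>X\<in>Pow U. subset_weight U p X * f X)"

lemma subset_expectation_contains_avoids:
  assumes U: "finite U" and "S \<subseteq> U" "T \<subseteq> U" "S \<inter> T = {}"
  shows "subset_expectation U p (\<lambda>X. of_bool (S \<subseteq> X \<and> X \<inter> T = {})) = (\<Prod>i\<in>S. p i) * (\<Prod>i\<in>T. 1 - p i)"
proof -
  \<comment> \<open>The indicator is absorbed into the factors: \<open>g\<close> vanishes on
    \<open>T\<close> and \<open>h\<close> on \<open>S\<close>, so every set violating the condition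
    gets product 0. What remains is the expansion of \<open>\<Prod>i\<in>U. g i + h i\<close> over
    all subsets.\<close>
  define g where "g i = (if i \<in> T then 0 else p i)" for i
  define h where "h i = (if i \<in> S then 0 else 1 - p i)" for i
  have "subset_weight U p X * of_bool (S \<subseteq> X \<and> X \<inter> T = {}) = prod g X * prod h (U - X)"
    if "X \<in> Pow U" for X
  proof (cases "S \<subseteq> X \<and> X \<inter> T = {}")
    case True
    then have "prod g X = prod p X" "prod h (U - X) = (\<Prod>i\<in>U - X. 1 - p i)"
      by (auto intro!: prod.cong simp: g_def h_def)
    then show ?thesis using True by (simp add: subset_weight_def)
  next
    case False
    have fin: "finite X" "finite (U - X)" using that U by (auto intro: finite_subset)
    from False consider i where "i \<in> S" "i \<notin> X" | i where "i \<in> X" "i \<in> T" by auto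
    then have "prod g X = 0 \<or> prod h (U - X) = 0"
      by cases (use fin assms in \<open>auto simp: prod_zero_iff g_def h_def\<close>)
    then show ?thesis using False by auto
  qed
  then have "subset_expectation U p (\<lambda>X. of_bool (S \<subseteq> X \<and> X \<inter> T = {}))
      = (\<Sum>X\<in>Pow U. prod g X * prod h (U - X))"
    by (simp add: subset_expectation_def)
  also have "\<dots> = (\<Prod>i\<in>U. g i + h i)"
    by (rule prod_add[OF U, symmetric])
  also have "\<dots> = (\<Prod>i\<in>U. (if i \<in> S then p i else 1) * (if i \<in> T then 1 - p i else 1))"
    using assms by (intro prod.cong) (auto simp: g_def h_def)
  also have "\<dots> = (\<Prod>i\<in>U. if i \<in> S then p i else 1) * (\<Prod>i\<in>U. if i \<in> T then 1 - p i else 1)"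
    by (rule prod.distrib)
  also have "\<dots> = (\<Prod>i\<in>S. p i) * (\<Prod>i\<in>T. 1 - p i)"
    using assms by (simp add: prod.If_cases Int_absorb1 flip: prod.inter_restrict)
  finally show ?thesis .
qed

lemma subset_expectation_avoids:
  assumes "finite U" "T \<subseteq> U"
  shows "subset_expectation U p (\<lambda>X. of_bool (X \<inter> T = {})) = (\<Prod>i\<in>T. 1 - p i)"
  using subset_expectation_contains_avoids[of U "{}" T p] assms by simp

lemma subset_expectation_contains:
  assumes "finite U" "S \<subseteq> U"
  shows "subset_expectation U p (\<lambda>X. of_bool (S \<subseteq> X)) = (\<Prod>i\<in>S. p i)"
  using subset_expectation_contains_avoids[of U S "{}" p] assms by simp

lemma subset_expectation_const:
  "finite U \<Longrightarrow> subset_expectation U p (\<lambda>X. a) = a"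
  using subset_expectation_avoids[of U "{}" p]
  by (simp add: subset_expectation_def flip: sum_distrib_right)

lemma subset_expectation_add:
  "subset_expectation U p (\<lambda>X. f X + g X) = subset_expectation U p f + subset_expectation U p g"
  by (simp add: subset_expectation_def distrib_left sum.distrib)

lemma subset_expectation_diff:
  "subset_expectation U p (\<lambda>X. f X - g X) = subset_expectation U p f - subset_expectation U p g"
  by (simp add: subset_expectation_def right_diff_distrib sum_subtractf)

lemma subset_expectation_cmult:
  "subset_expectation U p (\<lambda>X. a * f X) = a * subset_expectation U p f"
  by (simp add: subset_expectation_def sum_distrib_left mult.left_commute)

lemma subset_expectation_sum:
  "subset_expectation U p (\<lambda>X. \<Sum>i\<in>I. f i X) = (\<Sum>i\<in>I. subset_expectation U p (f i))"
  unfolding subset_expectation_def sum_distrib_left by (rule sum.swap)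

lemma subset_expectation_mono:
  assumes "\<And>i. i \<in> U \<Longrightarrow> 0 \<le> p i \<and> p i \<le> 1" "\<And>X. X \<subseteq> U \<Longrightarrow> f X \<le> g X"
  shows "subset_expectation U p f \<le> subset_expectation U p g"
  unfolding subset_expectation_def subset_weight_def
  by (intro sum_mono mult_left_mono mult_nonneg_nonneg prod_nonneg) (use assms in auto)

text \<open>First moment method: if every value lay below the mean, so would the largest one, yet
  the mean cannot exceed the maximum.\<close>

lemma exists_ge_subset_expectation:
  assumes "finite U" "\<And>i. i \<in> U \<Longrightarrow> 0 \<le> p i \<and> p i \<le> 1"
  shows "\<exists>X\<subseteq>U. subset_expectation U p f \<le> f X"
proof (rule ccontr)
  assume "\<not> ?thesis"
  then have *: "f X < subset_expectation U p f" if "X \<subseteq> U" for X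
    using that by (meson not_le_imp_less)
  define m where "m = Max (f ` Pow U)"
  have fin: "finite (f ` Pow U)" using assms by simp
  have "m \<in> f ` Pow U" unfolding m_def by (rule Max_in[OF fin]) auto
  then obtain Y where "Y \<subseteq> U" "m = f Y" by blast
  then have "m < subset_expectation U p f" using *[of Y] by simp
  moreover have "subset_expectation U p f \<le> subset_expectation U p (\<lambda>X. m)"
    by (rule subset_expectation_mono) (simp_all add: assms(2) m_def Max_ge[OF fin])
  ultimately show False using subset_expectation_const[OF assms(1), of p m] by simp
qed

lemma exists_le_subset_expectation:
  assumes "finite U" "\<And>i. i \<in> U \<Longrightarrow> 0 \<le> p i \<and> p i \<le> 1"
  shows "\<exists>X\<subseteq>U. f X \<le> subset_expectation U p f"
  using exists_ge_subset_expectation[of U p "\<lambda>X. - 1 * f X"] assms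
  unfolding subset_expectation_cmult by auto

text \<open>A variance bound. Expanding the square gives pairs \<open>i\<close>, \<open>j\<close>:
  the diagonal costs at most \<open>(a i)\<^sup>2\<close> beyond the product of means and
  \<open>k\<close>, and every other pair has covariance at most \<open>k\<close>. The loads of the
  nibble use a small positive \<open>k\<close>, the random reserve uses
  \<open>k = 0\<close>.\<close>

lemma subset_expectation_square_deviation:
  fixes P :: "'i \<Rightarrow> 'a set \<Rightarrow> bool" and a :: "'i \<Rightarrow> real"
  assumes U: "finite U" and p: "\<And>i. i \<in> U \<Longrightarrow> 0 \<le> p i \<and> p i \<le> 1"
    and I: "finite I" and a: "\<And>i. i \<in> I \<Longrightarrow> 0 \<le> a i" and k: "0 \<le> k"
    and m: "\<And>i. i \<in> I \<Longrightarrow> subset_expectation U p (\<lambda>X. of_bool (P i X)) = m i"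
    and cov: "\<And>i j. i \<in> I \<Longrightarrow> j \<in> I \<Longrightarrow> i \<noteq> j \<Longrightarrow>
      subset_expectation U p (\<lambda>X. of_bool (P i X \<and> P j X)) \<le> m i * m j + k"
  shows "subset_expectation U p (\<lambda>X. ((\<Sum>i\<in>I. a i * of_bool (P i X)) - (\<Sum>i\<in>I. a i * m i))\<^sup>2)
    \<le> (\<Sum>i\<in>I. (a i)\<^sup>2) + k * (\<Sum>i\<in>I. a i)\<^sup>2"
proof -
  let ?E = "subset_expectation U p"
  define A where "A = (\<Sum>i\<in>I. a i * m i)"
  define S where "S X = (\<Sum>i\<in>I. a i * of_bool (P i X))" for X
  have ES: "?E S = A"
    unfolding S_def A_def by (simp add: subset_expectation_sum subset_expectation_cmult m)
  have "?E (\<lambda>X. (S X - A)\<^sup>2) = ?E (\<lambda>X. (S X)\<^sup>2 + (A\<^sup>2 - (2 * A) * S X))"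
    by (simp add: power2_diff algebra_simps)
  also have "\<dots> = ?E (\<lambda>X. (S X)\<^sup>2) + (A\<^sup>2 - 2 * A * ?E S)"
    by (simp only: subset_expectation_add subset_expectation_diff subset_expectation_cmult
        subset_expectation_const[OF U])
  also have "\<dots> = ?E (\<lambda>X. (S X)\<^sup>2) - A\<^sup>2" by (simp add: ES power2_eq_square)
  also have "?E (\<lambda>X. (S X)\<^sup>2)
      = (\<Sum>i\<in>I. \<Sum>j\<in>I. (a i * a j) * ?E (\<lambda>X. of_bool (P i X \<and> P j X)))"
    unfolding subset_expectation_cmult[symmetric] subset_expectation_sum[symmetric]
    by (rule arg_cong[where f = ?E])
       (simp add: fun_eq_iff S_def power2_eq_square sum_product algebra_simps of_bool_conj)
  \<comment> \<open>For \<open>i = j\<close> the expectation is only bounded by 1; the summand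
    \<open>of_bool (i = j)\<close> pays for that.\<close>
  also have "\<dots> \<le> (\<Sum>i\<in>I. \<Sum>j\<in>I. (a i * a j) * (m i * m j + k + of_bool (i = j)))"
  proof (intro sum_mono mult_left_mono)
    fix i j assume ij: "i \<in> I" "j \<in> I"
    then show "0 \<le> a i * a j" by (simp add: a)
    show "?E (\<lambda>X. of_bool (P i X \<and> P j X)) \<le> m i * m j + k + of_bool (i = j)"
    proof (cases "i = j")
      case False
      then show ?thesis using cov[OF ij False] by simp
    next
      case True
      have "?E (\<lambda>X. of_bool (P i X \<and> P j X)) \<le> ?E (\<lambda>X. 1)"
        by (rule subset_expectation_mono[OF p]) auto
      then show ?thesis using True k by (simp add: subset_expectation_const[OF U] add_increasing)
    qed
  qed
  also have "\<dots> = (\<Sum>i\<in>I. \<Sum>j\<in>I. (a i * m i) * (a j * m j)) + k * (\<Sum>i\<in>I. \<Sum>j\<in>I. a i * a j)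
      + (\<Sum>i\<in>I. \<Sum>j\<in>I. a i * a j * of_bool (i = j))"
    by (simp add: distrib_left sum.distrib sum_distrib_left algebra_simps)
  also have "(\<Sum>i\<in>I. \<Sum>j\<in>I. a i * a j * of_bool (i = j)) = (\<Sum>i\<in>I. (a i)\<^sup>2)"
    using I by (simp add: of_bool_def power2_eq_square if_distrib[of "\<lambda>x. _ * x"] sum.delta cong: if_cong)
  also have "(\<Sum>i\<in>I. \<Sum>j\<in>I. (a i * m i) * (a j * m j)) = A\<^sup>2"
    by (simp add: A_def power2_eq_square sum_product)
  also have "(\<Sum>i\<in>I. \<Sum>j\<in>I. a i * a j) = (\<Sum>i\<in>I. a i)\<^sup>2"
    by (simp add: power2_eq_square sum_product)
  finally show ?thesis by (simp add: S_def A_def)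
qed

text \<open>The Weierstrass product inequality; in the induction the cross term
  \<open>p i * sum p S\<close> is nonnegative.\<close>

lemma prod_one_minus_ge:
  fixes p :: "'a \<Rightarrow> real"
  assumes "finite S" "\<And>i. i \<in> S \<Longrightarrow> 0 \<le> p i \<and> p i \<le> 1"
  shows "1 - (\<Sum>i\<in>S. p i) \<le> (\<Prod>i\<in>S. 1 - p i)"
  using assms
proof (induction S rule: finite_induct)
  case (insert i S)
  then have "1 - (\<Sum>i\<in>S. p i) \<le> (\<Prod>i\<in>S. 1 - p i)" "0 \<le> p i" "p i \<le> 1" "0 \<le> sum p S"
    by (auto intro: sum_nonneg)
  then have "(1 - p i) * (1 - sum p S) \<le> (1 - p i) * (\<Prod>i\<in>S. 1 - p i)" "0 \<le> p i * sum p S"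
    by (auto intro: mult_left_mono)
  then show ?case using insert.hyps by (simp add: algebra_simps)
qed simp

lemma sum_UN_le:
  fixes g :: "'a \<Rightarrow> real"
  assumes "finite I" "\<And>i. i \<in> I \<Longrightarrow> finite (A i)" "\<And>i x. i \<in> I \<Longrightarrow> x \<in> A i \<Longrightarrow> 0 \<le> g x"
  shows "(\<Sum>x\<in>(\<Union>i\<in>I. A i). g x) \<le> (\<Sum>i\<in>I. \<Sum>x\<in>A i. g x)"
  using assms
proof (induction I rule: finite_induct)
  case (insert i I)
  let ?B = "\<Union>i\<in>I. A i"
  have "sum g (A i \<union> ?B) + sum g (A i \<inter> ?B) = sum g (A i) + sum g ?B"
    by (rule sum.union_inter) (use insert in auto)
  moreover have "0 \<le> sum g (A i \<inter> ?B)" using insert.prems by (auto intro: sum_nonneg)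
  moreover have "sum g ?B \<le> (\<Sum>i\<in>I. sum g (A i))" using insert.prems by (intro insert.IH) auto
  ultimately show ?case using insert.hyps by simp
qed simp

subsection \<open>Linear 3-uniform hypergraphs\<close>

text \<open>Edges are abstract and \<open>V\<close> gives their vertices, so that the edges of a
  graph can serve as hyperedges directly. By \<open>linear\<close> two vertices lie in at most one
  common edge; the decorrelation and greedy arguments below rest on this.\<close>

locale linear_hypergraph =
  fixes E :: "'e set" and V :: "'e \<Rightarrow> 'x set"
  assumes finite_edges: "finite E"
    and card_edge: "e \<in> E \<Longrightarrow> card (V e) = 3"
    and linear: "e \<in> E \<Longrightarrow> f \<in> E \<Longrightarrow> e \<noteq> f \<Longrightarrow> card (V e \<inter> V f) \<le> 1"
begin

definition inc :: "'x \<Rightarrow> 'e set" where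
  "inc x = {e \<in> E. x \<in> V e}"

definition hmatching :: "'e set \<Rightarrow> bool" where
  "hmatching M \<longleftrightarrow> M \<subseteq> E \<and> (\<forall>e\<in>M. \<forall>f\<in>M. e \<noteq> f \<longrightarrow> V e \<inter> V f = {})"

definition fractional :: "('e \<Rightarrow> real) \<Rightarrow> bool" where
  "fractional w \<longleftrightarrow> (\<forall>e\<in>E. 0 \<le> w e) \<and> (\<forall>x. (\<Sum>e\<in>inc x. w e) \<le> 1)"

text \<open>For \<open>e \<in> E\<close> this contains \<open>e\<close> itself, so a random set
  missing \<open>nbhd e\<close> has neither picked \<open>e\<close> nor touched it.\<close>

definition nbhd :: "'e \<Rightarrow> 'e set" where
  "nbhd e = (\<Union>x\<in>V e. inc x)"

lemma finite_edge: "e \<in> E \<Longrightarrow> finite (V e)"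
  using card_edge[of e] by (metis card.infinite zero_neq_numeral)

lemma finite_inc [simp]: "finite (inc x)"
  using finite_edges by (simp add: inc_def)

lemma inc_subset: "inc x \<subseteq> E"
  by (auto simp: inc_def)

lemma edge_nonempty: "e \<in> E \<Longrightarrow> V e \<noteq> {}"
  using card_edge[of e] by auto

lemma nbhd_subset: "nbhd e \<subseteq> E"
  by (auto simp: nbhd_def inc_def)

lemma finite_nbhd [simp]: "finite (nbhd e)"
  using nbhd_subset finite_edges by (rule finite_subset)

lemma mem_nbhd: "f \<in> nbhd e \<longleftrightarrow> f \<in> E \<and> V e \<inter> V f \<noteq> {}"
  by (auto simp: nbhd_def inc_def)

lemma edges_equalI:
  assumes "e \<in> E" "f \<in> E" "x \<in> V e" "x \<in> V f" "y \<in> V e" "y \<in> V f" "x \<noteq> y"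
  shows "e = f"
proof (rule ccontr)
  assume "e \<noteq> f"
  then have "card (V e \<inter> V f) \<le> 1" using linear assms by simp
  moreover have "card {x, y} \<le> card (V e \<inter> V f)"
    using assms finite_edge by (intro card_mono) auto
  ultimately show False using \<open>x \<noteq> y\<close> by simp
qed

text \<open>A common neighbour away from \<open>x\<close> meets \<open>e\<close> and
  \<open>f\<close> in vertices other than \<open>x\<close>, giving one of \<open>2 * 2\<close>
  pairs. The two vertices of the pair differ, since \<open>e\<close> and \<open>f\<close> share only
  \<open>x\<close>, and by linearity they determine the neighbour.\<close>

lemma card_common_neighbours:
  assumes "e \<in> inc x" "f \<in> inc x" "e \<noteq> f"
  shows "card ((nbhd e - inc x) \<inter> (nbhd f - inc x)) \<le> 4"
proof -
  let ?T = "(nbhd e - inc x) \<inter> (nbhd f - inc x)"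
  let ?P = "(V e - {x}) \<times> (V f - {x})"
  have ef: "e \<in> E" "f \<in> E" "x \<in> V e" "x \<in> V f" using assms by (auto simp: inc_def)
  have "\<exists>z. z \<in> ?P \<and> fst z \<in> V g \<and> snd z \<in> V g" if "g \<in> ?T" for g
    using that ef by (auto simp: mem_nbhd inc_def)
  then obtain h where h: "\<And>g. g \<in> ?T \<Longrightarrow> h g \<in> ?P \<and> fst (h g) \<in> V g \<and> snd (h g) \<in> V g"
    by metis
  have "inj_on h ?T"
  proof (rule inj_onI)
    fix g g' assume g: "g \<in> ?T" "g' \<in> ?T" "h g = h g'"
    obtain y z where hyz: "h g = (y, z)" by fastforce
    have yz: "y \<in> V e" "y \<noteq> x" "z \<in> V f" "z \<noteq> x" "y \<in> V g" "z \<in> V g" "y \<in> V g'" "z \<in> V g'"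
      using h[OF g(1)] h[OF g(2)] g(3) hyz by auto
    have "y \<noteq> z" using edges_equalI[of e f x y] ef yz assms(3) by auto
    moreover have "g \<in> E" "g' \<in> E" using g nbhd_subset by auto
    ultimately show "g = g'" using edges_equalI yz by metis
  qed
  moreover have "finite ?P" using finite_edge ef by simp
  moreover have "h ` ?T \<subseteq> ?P" using h by (blast intro: image_subsetI)
  ultimately have "card ?T \<le> card ?P" by (metis card_inj_on_le)
  also have "\<dots> = 4" using ef card_edge by (simp add: card_cartesian_product card_Diff_singleton)
  finally show ?thesis .
qed

lemma finite_vertices: "finite (\<Union>(V ` E))"
  using finite_edges finite_edge by auto

lemma sum_inc_Int:
  assumes "finite F"
  shows "(\<Sum>x\<in>F. \<Sum>e\<in>inc x. g e x) = (\<Sum>e\<in>E. \<Sum>x\<in>V e \<inter> F. g e x)"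
proof -
  have "(\<Sum>x\<in>F. \<Sum>e\<in>inc x. g e x) = (\<Sum>x\<in>F. \<Sum>e\<in>E. if x \<in> V e then g e x else 0)"
    unfolding inc_def by (intro sum.cong[OF refl] sum.inter_filter[OF finite_edges])
  also have "\<dots> = (\<Sum>e\<in>E. \<Sum>x\<in>F. if x \<in> V e then g e x else 0)"
    by (rule sum.swap)
  also have "\<dots> = (\<Sum>e\<in>E. \<Sum>x\<in>V e \<inter> F. g e x)"
    using assms by (simp add: Int_commute flip: sum.inter_restrict)
  finally show ?thesis .
qed

lemma sum_inc: "(\<Sum>x\<in>\<Union>(V ` E). \<Sum>e\<in>inc x. g e x) = (\<Sum>e\<in>E. \<Sum>x\<in>V e. g e x)"
proof -
  have "V e \<inter> \<Union>(V ` E) = V e" if "e \<in> E" for e using that by blast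
  then show ?thesis unfolding sum_inc_Int[OF finite_vertices] by simp
qed

lemma sum_inc_const: "(\<Sum>x\<in>\<Union>(V ` E). \<Sum>e\<in>inc x. g e) = 3 * (\<Sum>e\<in>E. g e :: real)"
  unfolding sum_inc by (simp add: card_edge sum_distrib_left)

lemma hmatching_Un:
  assumes "hmatching M" "hmatching N" "\<And>e f. e \<in> M \<Longrightarrow> f \<in> N \<Longrightarrow> V e \<inter> V f = {}"
  shows "hmatching (M \<union> N)" "M \<inter> N = {}"
proof -
  show "hmatching (M \<union> N)"
    using assms unfolding hmatching_def by (auto 0 3 dest: assms(3))
  show "M \<inter> N = {}"
    using assms edge_nonempty unfolding hmatching_def by fastforce
qed

lemma finite_hmatching: "hmatching M \<Longrightarrow> finite M"
  unfolding hmatching_def using finite_edges finite_subset by blast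

end

subsection \<open>The nibble\<close>

locale nibble_round = linear_hypergraph E V for E :: "'e set" and V :: "'e \<Rightarrow> 'x set" +
  fixes w :: "'e \<Rightarrow> real" and D \<theta> :: real
  assumes w: "fractional w" and w_le: "e \<in> E \<Longrightarrow> w e \<le> 1 / D"
    and D: "1 \<le> D" and \<theta>: "0 < \<theta>" "\<theta> \<le> 1 / 5"
begin

definition p :: "'e \<Rightarrow> real" where "p e = \<theta> * w e"

abbreviation q :: "'e set \<Rightarrow> real" where "q S \<equiv> \<Prod>e\<in>S. 1 - p e"

text \<open>\<open>q S\<close> is the probability that no edge of \<open>S\<close> is picked.
  Dividing by \<open>q (nbhd e)\<close> gives the surviving weight the mean
  \<open>(1 - \<theta>) * w e\<close> for every edge, however crowded its neighbourhood is.\<close>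

definition c :: "'e \<Rightarrow> real" where "c e = (1 - \<theta>) * w e / q (nbhd e)"

abbreviation Ex :: "('e set \<Rightarrow> real) \<Rightarrow> real" where "Ex \<equiv> subset_expectation E p"

text \<open>An upper bound for the surviving weight at \<open>x\<close> in which picks at
  \<open>x\<close> itself are ignored. With \<open>inc x\<close> included, the indicators of all
  edges at \<open>x\<close> would depend on the same picks; without it they are nearly
  uncorrelated.\<close>

definition load :: "'x \<Rightarrow> 'e set \<Rightarrow> real" where
  "load x X = (\<Sum>e\<in>inc x. c e * of_bool (X \<inter> (nbhd e - inc x) = {}))"

definition survive :: "'e set \<Rightarrow> 'e \<Rightarrow> real" where
  "survive X e = c e * of_bool (X \<inter> nbhd e = {})"

text \<open>Conflicting picks are discarded altogether. The clause \<open>0 < w e\<close> keeps the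
  matching inside the support of \<open>w\<close>.\<close>

definition picked :: "'e set \<Rightarrow> 'e set" where
  "picked X = {e \<in> X. 0 < w e \<and> X \<inter> (nbhd e - {e}) = {}}"

lemma w_nonneg: "e \<in> E \<Longrightarrow> 0 \<le> w e"
  and w_sum: "(\<Sum>e\<in>inc x. w e) \<le> 1"
  using w by (auto simp: fractional_def)

lemma p_bounds: "e \<in> E \<Longrightarrow> 0 \<le> p e \<and> p e \<le> 1"
proof -
  assume e: "e \<in> E"
  have "w e \<le> 1" using w_le[OF e] D by (smt (verit) divide_le_eq_1)
  then show ?thesis using w_nonneg[OF e] \<theta> unfolding p_def
    by (simp add: mult_le_one)
qed

lemma q_bounds: "S \<subseteq> E \<Longrightarrow> 0 \<le> q S \<and> q S \<le> 1"
  using p_bounds by (auto intro!: prod_nonneg prod_le_1 simp: subset_eq)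

lemma q_ge: "S \<subseteq> E \<Longrightarrow> 1 - \<theta> * (\<Sum>e\<in>S. w e) \<le> q S"
  using prod_one_minus_ge[of S p] p_bounds finite_subset[OF _ finite_edges]
  by (auto simp: p_def sum_distrib_left subset_eq)

lemma q_inc_ge: "1 - \<theta> * (\<Sum>e\<in>inc x. w e) \<le> q (inc x)"
  by (rule q_ge[OF inc_subset])

lemma sum_nbhd_le: "e \<in> E \<Longrightarrow> (\<Sum>f\<in>nbhd e. w f) \<le> 3"
proof -
  assume e: "e \<in> E"
  have "(\<Sum>f\<in>nbhd e. w f) \<le> (\<Sum>x\<in>V e. \<Sum>f\<in>inc x. w f)"
    unfolding nbhd_def
    by (rule sum_UN_le) (use e finite_edge w_nonneg inc_subset in auto)
  also have "\<dots> \<le> (\<Sum>x\<in>V e. 1)" by (intro sum_mono w_sum)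
  finally show ?thesis using card_edge[OF e] by simp
qed

lemma q_nbhd_ge: "e \<in> E \<Longrightarrow> S \<subseteq> nbhd e \<Longrightarrow> 1 - 3 * \<theta> \<le> q S"
proof -
  assume e: "e \<in> E" and S: "S \<subseteq> nbhd e"
  have "(\<Sum>f\<in>S. w f) \<le> (\<Sum>f\<in>nbhd e. w f)"
    by (rule sum_mono2) (use S nbhd_subset w_nonneg in auto)
  then have "(\<Sum>f\<in>S. w f) \<le> 3" using sum_nbhd_le[OF e] by linarith
  then have "\<theta> * (\<Sum>f\<in>S. w f) \<le> \<theta> * 3" using \<theta> by (intro mult_left_mono) auto
  then show ?thesis using q_ge[of S] S nbhd_subset by fastforce
qed

lemma q_nbhd_pos: "e \<in> E \<Longrightarrow> 0 < q (nbhd e)"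
  using q_nbhd_ge[of e "nbhd e"] \<theta> by simp

lemma c_bounds: "e \<in> E \<Longrightarrow> 0 \<le> c e \<and> c e \<le> 2 * w e"
proof -
  assume e: "e \<in> E"
  \<comment> \<open>The bound \<open>\<theta> \<le> 1 / 5\<close> gives exactly
    \<open>1 - \<theta> \<le> 2 * (1 - 3 * \<theta>)\<close>.\<close>
  have "(1 - \<theta>) * w e \<le> (2 * q (nbhd e)) * w e"
    using q_nbhd_ge[OF e subset_refl] \<theta> w_nonneg[OF e] by (intro mult_right_mono) auto
  then show ?thesis using q_nbhd_pos[OF e] \<theta> w_nonneg[OF e] unfolding c_def
    by (simp add: divide_le_eq mult_ac)
qed

lemma expectation_survive:
  assumes "e \<in> E"
  shows "Ex (\<lambda>X. survive X e) = (1 - \<theta>) * w e"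
proof -
  have "a / y * y = a" if "0 < y" for a y :: real using that by simp
  then show ?thesis
    unfolding survive_def subset_expectation_cmult c_def
      subset_expectation_avoids[OF finite_edges nbhd_subset, of p e]
    using q_nbhd_pos[OF assms] by blast
qed

lemma q_nbhd_split: "e \<in> inc x \<Longrightarrow> q (nbhd e) = q (inc x) * q (nbhd e - inc x)"
proof -
  assume "e \<in> inc x"
  then have "inc x \<subseteq> nbhd e" by (auto simp: nbhd_def inc_def)
  then show ?thesis by (simp add: prod.subset_diff mult.commute)
qed

text \<open>Since \<open>q (nbhd e)\<close> splits off the factor \<open>q (inc x)\<close>, the sum
  collapses to \<open>(1 - \<theta>) * s / q (inc x)\<close>, where \<open>s \<le> 1\<close> is the
  weight at \<open>x\<close>. The factor \<open>1 - \<theta>\<close> in \<open>c\<close> suffices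
  because \<open>q (inc x) \<ge> 1 - \<theta> * s \<ge> (1 - \<theta>) * s\<close>.\<close>

lemma load_mean:
  "(\<Sum>e\<in>inc x. c e * q (nbhd e - inc x)) \<le> 1"
proof -
  have pos: "0 < 1 - \<theta> * (\<Sum>e\<in>inc x. w e)"
    using mult_left_mono[OF w_sum[of x] less_imp_le[OF \<theta>(1)]] \<theta> by linarith
  have "(\<Sum>e\<in>inc x. c e * q (nbhd e - inc x)) = (\<Sum>e\<in>inc x. (1 - \<theta>) * w e / q (inc x))"
  proof (rule sum.cong[OF refl])
    fix e assume e: "e \<in> inc x"
    then have pos: "0 < q (inc x) * q (nbhd e - inc x)"
      using q_nbhd_pos inc_subset q_nbhd_split[OF e] by (metis subsetD)
    have "a / (y * z) * z = a / y" if "0 < y * z" for a y z :: real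
      using that by (cases "z = 0") auto
    then show "c e * q (nbhd e - inc x) = (1 - \<theta>) * w e / q (inc x)"
      unfolding c_def q_nbhd_split[OF e] using pos by blast
  qed
  also have "\<dots> = (1 - \<theta>) * (\<Sum>e\<in>inc x. w e) / q (inc x)"
    by (simp add: sum_divide_distrib sum_distrib_left)
  also have "\<dots> \<le> 1"
  proof -
    have "(1 - \<theta>) * (\<Sum>e\<in>inc x. w e) \<le> q (inc x)"
      using q_inc_ge[of x] w_sum[of x] by (simp add: algebra_simps)
    moreover have "0 < q (inc x)" using q_inc_ge[of x] pos by linarith
    ultimately show ?thesis by (simp only: divide_le_eq_1_pos)
  qed
  finally show ?thesis .
qed

text \<open>Two indicators are correlated only through the common neighbours off \<open>x\<close>,
  of which there are at most four, each of weight at most \<open>1 / D\<close>. The bound is kept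
  proportional to the weight at \<open>x\<close>, so that summing it over all vertices costs a
  multiple of the total weight and not of the number of vertices.\<close>

lemma load_deviation:
  "Ex (\<lambda>X. (load x X - (\<Sum>e\<in>inc x. c e * q (nbhd e - inc x)))\<^sup>2) \<le> 20 * (\<Sum>e\<in>inc x. w e) / D"
proof -
  define s where "s = (\<Sum>e\<in>inc x. w e)"
  have E: "e \<in> inc x \<Longrightarrow> e \<in> E" for e using inc_subset by blast
  have s: "0 \<le> s" "s \<le> 1" unfolding s_def using w_sum E w_nonneg by (auto intro: sum_nonneg)
  have cov: "Ex (\<lambda>X. of_bool (X \<inter> (nbhd e - inc x) = {} \<and> X \<inter> (nbhd f - inc x) = {}))
      \<le> q (nbhd e - inc x) * q (nbhd f - inc x) + 4 * \<theta> / D"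
    if ef: "e \<in> inc x" "f \<in> inc x" "e \<noteq> f" for e f
  proof -
    let ?S = "nbhd e - inc x" and ?T = "nbhd f - inc x"
    have sub: "?S \<subseteq> E" "?T \<subseteq> E" using nbhd_subset by auto
    have "(\<Sum>g\<in>?S \<inter> ?T. w g) \<le> (\<Sum>g\<in>?S \<inter> ?T. 1 / D)"
      by (rule sum_mono) (use w_le sub in blast)
    also have "\<dots> \<le> 4 / D"
      using card_common_neighbours[OF ef] D by (simp add: divide_right_mono)
    finally have "\<theta> * (\<Sum>g\<in>?S \<inter> ?T. w g) \<le> \<theta> * (4 / D)"
      using \<theta> by (intro mult_left_mono) auto
    then have int: "1 - 4 * \<theta> / D \<le> q (?S \<inter> ?T)" using q_ge[of "?S \<inter> ?T"] sub by fastforce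
    have un: "0 \<le> q (?S \<union> ?T)" "q (?S \<union> ?T) \<le> 1" using q_bounds[of "?S \<union> ?T"] sub by auto
    have "q (?S \<union> ?T) * (1 - 4 * \<theta> / D) \<le> q (?S \<union> ?T) * q (?S \<inter> ?T)"
      using int un by (intro mult_left_mono)
    also have "\<dots> = q ?S * q ?T" by (rule prod.union_inter) auto
    finally have "q (?S \<union> ?T) \<le> q ?S * q ?T + q (?S \<union> ?T) * (4 * \<theta> / D)"
      by (simp add: algebra_simps)
    also have "\<dots> \<le> q ?S * q ?T + 1 * (4 * \<theta> / D)"
      using un \<theta> D by (intro add_left_mono mult_right_mono) auto
    finally have "q (?S \<union> ?T) \<le> q ?S * q ?T + 4 * \<theta> / D" by simp
    moreover have "(X \<inter> ?S = {} \<and> X \<inter> ?T = {}) \<longleftrightarrow> X \<inter> (?S \<union> ?T) = {}" for X by blast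
    ultimately show ?thesis
      using subset_expectation_avoids[OF finite_edges, of "?S \<union> ?T" p] sub by simp
  qed
  have "Ex (\<lambda>X. (load x X - (\<Sum>e\<in>inc x. c e * q (nbhd e - inc x)))\<^sup>2)
      \<le> (\<Sum>e\<in>inc x. (c e)\<^sup>2) + 4 * \<theta> / D * (\<Sum>e\<in>inc x. c e)\<^sup>2"
    unfolding load_def
  proof (rule subset_expectation_square_deviation[OF finite_edges p_bounds])
    show "Ex (\<lambda>X. of_bool (X \<inter> (nbhd e - inc x) = {})) = q (nbhd e - inc x)" for e
      by (rule subset_expectation_avoids[OF finite_edges]) (use nbhd_subset in auto)
  qed (use c_bounds E cov \<theta> D in auto)
  \<comment> \<open>The constant 20 is 4 from the squares, by \<open>c e \<le> 2 * w e\<close> and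
    \<open>w e \<le> 1 / D\<close>, plus 16 from the covariances, by
    \<open>s\<^sup>2 \<le> s\<close>.\<close>
  also have "(\<Sum>e\<in>inc x. (c e)\<^sup>2) \<le> (\<Sum>e\<in>inc x. 4 / D * w e)"
  proof (rule sum_mono)
    fix e assume "e \<in> inc x"
    then have e: "e \<in> E" by (rule E)
    have "(c e)\<^sup>2 \<le> (2 * w e) * (2 * w e)"
      unfolding power2_eq_square using c_bounds[OF e] by (intro mult_mono) auto
    also have "\<dots> \<le> (2 * (1 / D)) * (2 * w e)"
      using w_le[OF e] w_nonneg[OF e] by (intro mult_right_mono) auto
    finally show "(c e)\<^sup>2 \<le> 4 / D * w e" by simp
  qed
  also have "(\<Sum>e\<in>inc x. 4 / D * w e) = 4 * s / D" by (simp add: s_def flip: sum_distrib_left sum_divide_distrib)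
  also have "4 * \<theta> / D * (\<Sum>e\<in>inc x. c e)\<^sup>2 \<le> 4 / D * (4 * s)"
  proof (intro mult_mono)
    have "(\<Sum>e\<in>inc x. c e) \<le> (\<Sum>e\<in>inc x. 2 * w e)" "0 \<le> (\<Sum>e\<in>inc x. c e)"
      using c_bounds E by (auto intro!: sum_mono sum_nonneg)
    then have "(\<Sum>e\<in>inc x. c e)\<^sup>2 \<le> (2 * s)\<^sup>2"
      by (intro power_mono) (auto simp: s_def sum_distrib_left)
    also have "\<dots> = 4 * (s * s)" by (simp add: power2_eq_square)
    also have "\<dots> \<le> 4 * s" using s mult_left_mono[of s 1 s] by simp
    finally show "(\<Sum>e\<in>inc x. c e)\<^sup>2 \<le> 4 * s" .
    show "4 * \<theta> / D \<le> 4 / D" using \<theta> D by (simp add: divide_right_mono)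
  qed (use D in auto)
  finally show ?thesis by (simp add: s_def[symmetric] add_divide_distrib)
qed

end

section \<open>Picked edges and residual weights of one round\<close>

context nibble_round
begin

lemma hmatching_picked:
  assumes "X \<subseteq> E"
  shows "hmatching (picked X)"
  unfolding hmatching_def
proof (intro conjI ballI impI)
  fix e f assume "e \<in> picked X" "f \<in> picked X" "e \<noteq> f"
  then have "f \<in> X" "f \<notin> nbhd e" by (auto simp: picked_def)
  then show "V e \<inter> V f = {}" using assms by (auto simp: mem_nbhd)
qed (use assms in \<open>auto simp: picked_def\<close>)

lemma expectation_picked: "\<theta> * (1 - 3 * \<theta>) * (\<Sum>e\<in>E. w e) \<le> Ex (\<lambda>X. real (card (picked X)))"
proof -
  have "\<theta> * (1 - 3 * \<theta>) * (\<Sum>e\<in>E. w e) = (\<Sum>e\<in>E. \<theta> * w e * (1 - 3 * \<theta>))"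
    by (simp add: sum_distrib_left sum_distrib_right mult_ac)
  also have "\<dots> \<le> (\<Sum>e\<in>E. Ex (\<lambda>X. of_bool ({e} \<subseteq> X \<and> X \<inter> (nbhd e - {e}) = {})))"
  proof (rule sum_mono)
    fix e assume e: "e \<in> E"
    have "\<theta> * w e * (1 - 3 * \<theta>) \<le> p e * q (nbhd e - {e})"
      unfolding p_def[of e] using q_nbhd_ge[OF e, of "nbhd e - {e}"] w_nonneg[OF e] \<theta>
      by (intro mult_left_mono) auto
    also have "\<dots> = Ex (\<lambda>X. of_bool ({e} \<subseteq> X \<and> X \<inter> (nbhd e - {e}) = {}))"
      using subset_expectation_contains_avoids[OF finite_edges, of "{e}" "nbhd e - {e}" p] e nbhd_subset
      by force
    finally show "\<theta> * w e * (1 - 3 * \<theta>) \<le> Ex (\<lambda>X. of_bool ({e} \<subseteq> X \<and> X \<inter> (nbhd e - {e}) = {}))" .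
  qed
  also have "\<dots> = (\<Sum>e\<in>E. Ex (\<lambda>X. of_bool (e \<in> picked X)))"
  proof (rule sum.cong[OF refl])
    fix e assume e: "e \<in> E"
    \<comment> \<open>The two events differ only for edges of weight 0, and those are picked with
      probability 0.\<close>
    show "Ex (\<lambda>X. of_bool ({e} \<subseteq> X \<and> X \<inter> (nbhd e - {e}) = {})) = Ex (\<lambda>X. of_bool (e \<in> picked X))"
    proof (cases "w e = 0")
      case False
      then show ?thesis using w_nonneg[OF e] by (simp add: picked_def)
    next
      case True
      then have "subset_expectation E p (\<lambda>X. of_bool ({e} \<subseteq> X \<and> X \<inter> (nbhd e - {e}) = {})) = 0"
        using subset_expectation_contains_avoids[OF finite_edges, of "{e}" "nbhd e - {e}" p] e nbhd_subset
        by (force simp: p_def)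
      moreover have "subset_expectation E p (\<lambda>X. of_bool (e \<in> picked X)) = 0"
        using True by (simp add: picked_def subset_expectation_def)
      ultimately show ?thesis by simp
    qed
  qed
  also have "\<dots> = Ex (\<lambda>X. \<Sum>e\<in>E. of_bool (e \<in> picked X))"
    by (simp add: subset_expectation_sum)
  also have "\<dots> \<le> Ex (\<lambda>X. real (card (picked X)))"
  proof (rule subset_expectation_mono[OF p_bounds])
    fix X assume "X \<subseteq> E"
    then have "E \<inter> {e. e \<in> picked X} = picked X" by (auto simp: picked_def)
    then show "(\<Sum>e\<in>E. of_bool (e \<in> picked X)) \<le> real (card (picked X))"
      using finite_edges by simp
  qed
  finally show ?thesis .
qed

text \<open>The surviving weights are rescaled to have mean \<open>(1 - \<theta>) * w e\<close>; they are dropped at the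
  few vertices where the load deviates from its mean, so that the result is again fractional.\<close>

definition residual :: "real \<Rightarrow> 'e set \<Rightarrow> 'e \<Rightarrow> real" where
  "residual \<tau> X e = (if \<forall>x\<in>V e. load x X \<le> 1 + \<tau> then survive X e / (1 + \<tau>) else 0)"

lemma survive_nonneg: "e \<in> E \<Longrightarrow> 0 \<le> survive X e"
  unfolding survive_def using c_bounds by simp

lemma sum_survive_le_load: "(\<Sum>e\<in>inc x. survive X e) \<le> load x X"
  unfolding load_def survive_def
  by (intro sum_mono mult_left_mono) (use c_bounds inc_subset in auto)

text \<open>At a vertex of load at most \<open>1 + \<tau>\<close> the scaling by
  \<open>1 + \<tau>\<close> suffices; at an overloaded vertex every incident edge has been
  dropped.\<close>

lemma fractional_residual:
  assumes "0 < \<tau>"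
  shows "fractional (residual \<tau> X)"
  unfolding fractional_def
proof (intro conjI ballI allI)
  fix e assume "e \<in> E"
  then show "0 \<le> residual \<tau> X e" using survive_nonneg assms by (simp add: residual_def)
next
  fix x
  show "(\<Sum>e\<in>inc x. residual \<tau> X e) \<le> 1"
  proof (cases "load x X \<le> 1 + \<tau>")
    case True
    have "(\<Sum>e\<in>inc x. residual \<tau> X e) \<le> (\<Sum>e\<in>inc x. survive X e / (1 + \<tau>))"
    proof (rule sum_mono)
      fix e assume "e \<in> inc x"
      then have "0 \<le> survive X e" using survive_nonneg inc_subset by blast
      then show "residual \<tau> X e \<le> survive X e / (1 + \<tau>)" using assms by (simp add: residual_def)
    qed
    also have "\<dots> \<le> load x X / (1 + \<tau>)"
      using sum_survive_le_load assms by (simp add: divide_right_mono flip: sum_divide_distrib)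
    also have "\<dots> \<le> 1" using True assms by simp
    finally show ?thesis .
  next
    case False
    then have "residual \<tau> X e = 0" if "e \<in> inc x" for e
      using that by (auto simp: residual_def inc_def)
    then show ?thesis by simp
  qed
qed

text \<open>Survivors may at most double their weight. A round therefore halves \<open>D\<close>,
  which is affordable because the number of rounds is fixed in advance.\<close>

lemma residual_le:
  assumes "0 < \<tau>" "e \<in> E"
  shows "residual \<tau> X e \<le> 1 / (D / 2)"
proof -
  have "residual \<tau> X e \<le> survive X e"
    using assms survive_nonneg[of e X] by (simp add: residual_def divide_le_eq mult_left_mono algebra_simps)
  also have "\<dots> \<le> c e" using c_bounds[of e] assms by (simp add: survive_def)
  also have "\<dots> \<le> 2 * (1 / D)" using c_bounds[of e] w_le[of e] assms by simp
  finally show ?thesis by simp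
qed

lemma residual_support:
  assumes "0 < \<tau>" "e \<in> E" "0 < residual \<tau> X e"
  shows "0 < w e" "X \<inter> nbhd e = {}"
proof -
  have "0 < survive X e" using assms by (auto simp: residual_def zero_less_divide_iff split: if_splits)
  then show "0 < w e" "X \<inter> nbhd e = {}"
    using c_bounds[OF assms(2)] by (auto simp: survive_def of_bool_def split: if_splits)
qed

text \<open>A Chebyshev argument: the weight dropped at an overloaded vertex is charged to the
  squared deviation of its load. The constant 60 is 20 from \<open>load_deviation\<close> times 3,
  as every edge is counted at its three vertices.\<close>

lemma expectation_residual:
  assumes \<tau>: "0 < \<tau>"
  shows "((1 - \<theta>) - 60 * (1 + \<tau>) / (\<tau>\<^sup>2 * D)) / (1 + \<tau>) * (\<Sum>e\<in>E. w e)
    \<le> Ex (\<lambda>X. \<Sum>e\<in>E. residual \<tau> X e)"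
proof -
  define W where "W = (\<Sum>e\<in>E. w e)"
  define m where "m x = (\<Sum>e\<in>inc x. c e * q (nbhd e - inc x))" for x
  \<comment> \<open>\<open>A\<close> is the least constant with
    \<open>1 + t \<le> A * t\<^sup>2\<close> for all \<open>t \<ge> \<tau>\<close>; equality holds
    at \<open>t = \<tau>\<close>. Applied to a load \<open>1 + t\<close>, whose mean is at most 1,
    it bounds the load by \<open>A\<close> times its squared deviation.\<close>
  define A where "A = (1 + \<tau>) / \<tau>\<^sup>2"
  have A: "0 \<le> A" using \<tau> by (simp add: A_def)
  let ?VE = "\<Union>(V ` E)"
  have pt: "(\<Sum>e\<in>E. survive X e) - (\<Sum>x\<in>?VE. A * (load x X - m x)\<^sup>2)
      \<le> (1 + \<tau>) * (\<Sum>e\<in>E. residual \<tau> X e)" for X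
  proof -
    have "(\<Sum>e\<in>E. survive X e) - (1 + \<tau>) * (\<Sum>e\<in>E. residual \<tau> X e)
        = (\<Sum>e\<in>E. survive X e - (1 + \<tau>) * residual \<tau> X e)"
      by (simp add: sum_subtractf sum_distrib_left)
    also have "\<dots> \<le> (\<Sum>e\<in>E. \<Sum>x\<in>V e. of_bool (1 + \<tau> < load x X) * survive X e)"
    proof (rule sum_mono)
      fix e assume e: "e \<in> E"
      show "survive X e - (1 + \<tau>) * residual \<tau> X e
          \<le> (\<Sum>x\<in>V e. of_bool (1 + \<tau> < load x X) * survive X e)"
      proof (cases "\<forall>x\<in>V e. load x X \<le> 1 + \<tau>")
        case True
        then show ?thesis using \<tau> survive_nonneg[OF e, of X]
          by (auto simp: residual_def intro: sum_nonneg)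
      next
        case False
        then obtain x where x: "x \<in> V e" "1 + \<tau> < load x X" by force
        have "survive X e = of_bool (1 + \<tau> < load x X) * survive X e" using x by simp
        also have "\<dots> \<le> (\<Sum>x\<in>V e. of_bool (1 + \<tau> < load x X) * survive X e)"
          using x(1) finite_edge[OF e] survive_nonneg[OF e, of X] by (intro member_le_sum) auto
        finally show ?thesis using False by (auto simp: residual_def)
      qed
    qed
    also have "\<dots> = (\<Sum>x\<in>?VE. \<Sum>e\<in>inc x. of_bool (1 + \<tau> < load x X) * survive X e)"
      by (rule sum_inc[symmetric])
    also have "\<dots> \<le> (\<Sum>x\<in>?VE. A * (load x X - m x)\<^sup>2)"
    proof (rule sum_mono)
      fix x
      show "(\<Sum>e\<in>inc x. of_bool (1 + \<tau> < load x X) * survive X e) \<le> A * (load x X - m x)\<^sup>2"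
      proof (cases "1 + \<tau> < load x X")
        case False
        then show ?thesis using A by simp
      next
        case True
        define t where "t = load x X - 1"
        have t: "\<tau> < t" using True by (simp add: t_def)
        have "(1 + t) * \<tau>\<^sup>2 \<le> (1 + \<tau>) * t\<^sup>2"
        proof -
          have "0 \<le> (t - \<tau>) * (t + \<tau> + t * \<tau>)" using t \<tau> by simp
          also have "\<dots> = (1 + \<tau>) * t\<^sup>2 - (1 + t) * \<tau>\<^sup>2" by (simp add: algebra_simps power2_eq_square)
          finally show ?thesis by simp
        qed
        then have "1 + t \<le> A * t\<^sup>2" using \<tau> by (simp add: A_def field_simps)
        also have "\<dots> \<le> A * (load x X - m x)\<^sup>2"
          using A load_mean[of x] t \<tau> by (intro mult_left_mono power_mono) (auto simp: m_def t_def)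
        finally show ?thesis using sum_survive_le_load[of X x] True by (simp add: t_def)
      qed
    qed
    finally show ?thesis by simp
  qed
  have "(1 - \<theta>) * W - A * (60 * W / D)
      \<le> (\<Sum>e\<in>E. (1 - \<theta>) * w e) - (\<Sum>x\<in>?VE. A * (20 * (\<Sum>e\<in>inc x. w e) / D))"
  proof -
    have "(\<Sum>x\<in>?VE. A * (20 * (\<Sum>e\<in>inc x. w e) / D))
        = A * 20 / D * (\<Sum>x\<in>?VE. \<Sum>e\<in>inc x. w e)"
      unfolding sum_distrib_left[of "A * 20 / D" "\<lambda>x. \<Sum>e\<in>inc x. w e" ?VE]
      by (rule sum.cong) simp_all
    also have "\<dots> = A * (60 * W / D)" by (simp add: sum_inc_const W_def)
    finally show ?thesis by (simp add: W_def sum_distrib_left)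
  qed
  also have "\<dots> \<le> Ex (\<lambda>X. \<Sum>e\<in>E. survive X e) - Ex (\<lambda>X. \<Sum>x\<in>?VE. A * (load x X - m x)\<^sup>2)"
    unfolding subset_expectation_sum subset_expectation_cmult
    by (intro diff_mono sum_mono mult_left_mono)
       (use expectation_survive load_deviation A in \<open>auto simp: m_def\<close>)
  also have "\<dots> \<le> Ex (\<lambda>X. (1 + \<tau>) * (\<Sum>e\<in>E. residual \<tau> X e))"
    unfolding subset_expectation_diff[symmetric]
    by (rule subset_expectation_mono[OF p_bounds]) (use pt in auto)
  finally have "(1 - \<theta>) * W - A * (60 * W / D) \<le> (1 + \<tau>) * Ex (\<lambda>X. \<Sum>e\<in>E. residual \<tau> X e)"
    by (simp add: subset_expectation_cmult)
  moreover have "(1 - \<theta>) * W - A * (60 * W / D) = ((1 - \<theta>) - 60 * (1 + \<tau>) / (\<tau>\<^sup>2 * D)) * W"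
    by (simp add: A_def algebra_simps)
  ultimately show ?thesis using \<tau> by (simp add: W_def[symmetric] divide_le_eq mult_ac)
qed

end

section \<open>Iterating the nibble\<close>

context linear_hypergraph
begin

text \<open>Quantifying over all weights lets the induction pass to a residual weight. The
  positivity clause makes the later matching avoid the edges picked earlier, because residual
  weights vanish next to picks.\<close>

definition nibble_ratio :: "real \<Rightarrow> real \<Rightarrow> bool" where
  "nibble_ratio \<rho> D \<longleftrightarrow> (\<forall>w. fractional w \<longrightarrow> (\<forall>e\<in>E. w e \<le> 1 / D) \<longrightarrow>
    (\<exists>M. hmatching M \<and> (\<forall>e\<in>M. 0 < w e) \<and> \<rho> * (\<Sum>e\<in>E. w e) \<le> real (card M)))"

lemma nibble_ratio_step:
  assumes ratio: "nibble_ratio \<rho> (D / 2)" and \<rho>: "0 \<le> \<rho>" "\<rho> \<le> 1"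
    and \<theta>: "0 < \<theta>" "\<theta> \<le> 1 / 5" and D_ge: "120 / \<theta> ^ 6 \<le> D"
  shows "nibble_ratio (\<rho> + \<theta> * (1 - \<rho>) - 5 * \<theta>\<^sup>2) D"
  unfolding nibble_ratio_def
proof (intro allI impI)
  fix w :: "'e \<Rightarrow> real"
  assume w: "fractional w" "\<forall>e\<in>E. w e \<le> 1 / D"
  have "\<theta> ^ 6 \<le> 1" using \<theta> by (simp add: power_le_one)
  then have "1 \<le> 120 / \<theta> ^ 6" using \<theta> by simp
  then have "1 \<le> D" using D_ge by simp
  then interpret nibble_round E V w D \<theta>
    by unfold_locales (use w \<theta> in auto)
  define W where "W = (\<Sum>e\<in>E. w e)"
  have W: "0 \<le> W" unfolding W_def by (intro sum_nonneg w_nonneg)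
  \<comment> \<open>With \<open>\<tau>\<close> quadratic in \<open>\<theta>\<close> the truncation
    losses are of second order; \<open>120 / \<theta> ^ 6 \<le> D\<close> then makes the Chebyshev
    error at most \<open>\<tau>\<close>.\<close>
  define \<tau> where "\<tau> = \<theta>\<^sup>2"
  have \<tau>: "0 < \<tau>" "\<tau> \<le> 1" using \<theta> by (auto simp: \<tau>_def power_le_one)
  \<comment> \<open>The edges secured now and the \<open>\<rho>\<close> share guaranteed from the
    residual weight are averaged jointly, so that one \<open>X\<close> is good for both.\<close>
  define G where "G X = real (card (picked X)) + \<rho> * (\<Sum>e\<in>E. residual \<tau> X e)" for X
  obtain X where X: "X \<subseteq> E" and "Ex G \<le> G X"
    using exists_ge_subset_expectation[of E p G, OF finite_edges] p_bounds by blast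
  then have X_ge: "\<theta> * (1 - 3 * \<theta>) * W
      + \<rho> * (((1 - \<theta>) - 60 * (1 + \<tau>) / (\<tau>\<^sup>2 * D)) / (1 + \<tau>) * W)
      \<le> real (card (picked X)) + \<rho> * (\<Sum>e\<in>E. residual \<tau> X e)"
    using expectation_picked mult_left_mono[OF expectation_residual[OF \<tau>(1)] \<rho>(1)]
    unfolding G_def subset_expectation_add subset_expectation_cmult W_def by linarith
  obtain M where M: "hmatching M" "\<forall>e\<in>M. 0 < residual \<tau> X e"
    "\<rho> * (\<Sum>e\<in>E. residual \<tau> X e) \<le> real (card M)"
    using ratio fractional_residual[OF \<tau>(1), of X] residual_le[OF \<tau>(1), of _ X]
    unfolding nibble_ratio_def by blast
  have ME: "M \<subseteq> E" using M(1) by (simp add: hmatching_def)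
  have disj: "V e \<inter> V f = {}" if "e \<in> picked X" "f \<in> M" for e f
  proof -
    have "X \<inter> nbhd f = {}" using residual_support(2)[OF \<tau>(1)] M(2) ME that(2) by blast
    moreover have "e \<in> X" using that(1) by (simp add: picked_def)
    ultimately have "e \<in> E" "e \<notin> nbhd f" using X by auto
    then show ?thesis by (auto simp: mem_nbhd)
  qed
  note un = hmatching_Un[OF hmatching_picked[OF X] M(1) disj]
  \<comment> \<open>The constant 5 is 3 from conflicts among the picks plus 2 from the truncation,
    the latter multiplied by \<open>\<rho> \<le> 1\<close>.\<close>
  have "\<rho> + \<theta> * (1 - \<rho>) - 5 * \<theta>\<^sup>2
      \<le> \<theta> * (1 - 3 * \<theta>) + \<rho> * (((1 - \<theta>) - 60 * (1 + \<tau>) / (\<tau>\<^sup>2 * D)) / (1 + \<tau>))"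
  proof -
    have "120 \<le> \<theta> ^ 6 * D"
      using \<theta> D_ge by (simp add: pos_divide_le_eq mult.commute)
    also have "\<theta> ^ 6 * D = \<tau> * (\<tau>\<^sup>2 * D)" by (simp add: \<tau>_def eval_nat_numeral)
    finally have big: "120 \<le> \<tau> * (\<tau>\<^sup>2 * D)" .
    have "60 * (1 + \<tau>) / (\<tau>\<^sup>2 * D) \<le> 120 / (\<tau>\<^sup>2 * D)"
      using \<tau> \<open>1 \<le> D\<close> by (intro divide_right_mono) auto
    also have "\<dots> \<le> \<tau>" using big \<tau> \<open>1 \<le> D\<close> by (simp add: divide_le_eq)
    finally have err: "60 * (1 + \<tau>) / (\<tau>\<^sup>2 * D) \<le> \<tau>" .
    have "(1 - \<theta> - 2 * \<tau>) * (1 + \<tau>) \<le> (1 - \<theta>) - \<tau>"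
    proof -
      have "(1 - \<theta>) - \<tau> - (1 - \<theta> - 2 * \<tau>) * (1 + \<tau>) = \<tau> * \<theta> + 2 * \<tau> * \<tau>"
        by (simp add: algebra_simps)
      moreover have "0 \<le> \<tau> * \<theta> + 2 * \<tau> * \<tau>" using \<theta> \<tau> by simp
      ultimately show ?thesis by linarith
    qed
    also have "\<dots> \<le> (1 - \<theta>) - 60 * (1 + \<tau>) / (\<tau>\<^sup>2 * D)" using err by simp
    finally have "1 - \<theta> - 2 * \<tau> \<le> ((1 - \<theta>) - 60 * (1 + \<tau>) / (\<tau>\<^sup>2 * D)) / (1 + \<tau>)"
      using \<tau> by (simp add: le_divide_eq)
    then have "\<rho> * (1 - \<theta> - 2 * \<tau>) \<le> \<rho> * (((1 - \<theta>) - 60 * (1 + \<tau>) / (\<tau>\<^sup>2 * D)) / (1 + \<tau>))"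
      using \<rho> by (intro mult_left_mono)
    moreover have "\<rho> * \<tau> \<le> 1 * \<tau>" using \<rho> \<tau> by (intro mult_right_mono) auto
    ultimately show ?thesis by (simp add: \<tau>_def algebra_simps power2_eq_square)
  qed
  then have "(\<rho> + \<theta> * (1 - \<rho>) - 5 * \<theta>\<^sup>2) * W
      \<le> (\<theta> * (1 - 3 * \<theta>) + \<rho> * (((1 - \<theta>) - 60 * (1 + \<tau>) / (\<tau>\<^sup>2 * D)) / (1 + \<tau>))) * W"
    using W by (intro mult_right_mono)
  also have "\<dots> \<le> real (card (picked X)) + \<rho> * (\<Sum>e\<in>E. residual \<tau> X e)"
    using X_ge by (simp add: distrib_right)
  also have "\<dots> \<le> real (card (picked X) + card M)" using M(3) by simp
  also have "card (picked X) + card M = card (picked X \<union> M)"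
    using un(2) finite_hmatching M(1) hmatching_picked[OF X] by (intro card_Un_disjoint[symmetric]) auto
  finally have "(\<rho> + \<theta> * (1 - \<rho>) - 5 * \<theta>\<^sup>2) * (\<Sum>e\<in>E. w e) \<le> real (card (picked X \<union> M))"
    by (simp add: W_def)
  moreover have "\<forall>e\<in>picked X \<union> M. 0 < w e"
    using residual_support(1)[OF \<tau>(1)] M(2) ME by (auto simp: picked_def)
  ultimately show "\<exists>M. hmatching M \<and> (\<forall>e\<in>M. 0 < w e)
      \<and> (\<rho> + \<theta> * (1 - \<rho>) - 5 * \<theta>\<^sup>2) * (\<Sum>e\<in>E. w e) \<le> real (card M)"
    using un(1) by blast
qed

text \<open>The improvement map has fixed point \<open>1 - 5 * \<theta>\<close> and contracts the
  distance to it by \<open>1 - \<theta>\<close>; the formula is its orbit started at 0. The factor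
  \<open>2 ^ n\<close> prepays the halving of \<open>D\<close> in each round.\<close>

lemma nibble_ratio_iterate:
  assumes \<theta>: "0 < \<theta>" "\<theta> \<le> 1 / 5" and D: "2 ^ n * (120 / \<theta> ^ 6) \<le> D"
  shows "nibble_ratio ((1 - 5 * \<theta>) * (1 - (1 - \<theta>) ^ n)) D"
  using D
proof (induction n arbitrary: D)
  case 0
  have "hmatching {}" by (simp add: hmatching_def)
  then show ?case unfolding nibble_ratio_def by (intro allI impI exI[of _ "{}"]) simp
next
  case (Suc n)
  let ?\<rho> = "(1 - 5 * \<theta>) * (1 - (1 - \<theta>) ^ n)"
  have pw: "0 \<le> (1 - \<theta>) ^ n" "(1 - \<theta>) ^ n \<le> 1" using \<theta> by (auto intro: power_le_one)
  have "nibble_ratio ?\<rho> (D / 2)" using Suc by simp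
  moreover have "0 \<le> ?\<rho>" "?\<rho> \<le> 1" using pw \<theta> by (auto intro: mult_le_one)
  moreover have "120 / \<theta> ^ 6 \<le> D"
  proof -
    have "1 * (120 / \<theta> ^ 6) \<le> 2 ^ Suc n * (120 / \<theta> ^ 6)"
      using \<theta> by (intro mult_right_mono) (auto simp: two_realpow_ge_one simp del: power_Suc)
    then show ?thesis using Suc.prems by linarith
  qed
  ultimately have "nibble_ratio (?\<rho> + \<theta> * (1 - ?\<rho>) - 5 * \<theta>\<^sup>2) D"
    using \<theta> by (intro nibble_ratio_step)
  moreover have "?\<rho> + \<theta> * (1 - ?\<rho>) - 5 * \<theta>\<^sup>2 = (1 - 5 * \<theta>) * (1 - (1 - \<theta>) ^ Suc n)"
    by (simp add: algebra_simps power2_eq_square)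
  ultimately show ?case by simp
qed

end

text \<open>First \<open>\<theta>\<close> is chosen so that the fixed point is within
  \<open>\<delta> / 2\<close> of 1, then \<open>n\<close> so that the orbit is within another
  \<open>\<delta> / 2\<close>. Both depend on \<open>\<delta>\<close> alone, hence so does
  \<open>D0\<close>.\<close>

theorem fractional_to_matching:
  assumes "0 < \<delta>"
  shows "\<exists>D0 > 0. \<forall>(E :: 'e set) (V :: 'e \<Rightarrow> 'x set) w D. linear_hypergraph E V \<longrightarrow> D0 \<le> D \<longrightarrow>
    linear_hypergraph.fractional E V w \<longrightarrow> (\<forall>e\<in>E. w e \<le> 1 / D) \<longrightarrow>
    (\<exists>M. linear_hypergraph.hmatching E V M \<and> (\<forall>e\<in>M. 0 < w e)
      \<and> (1 - \<delta>) * (\<Sum>e\<in>E. w e) \<le> real (card M))"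
proof -
  define \<theta> where "\<theta> = min (\<delta> / 10) (1 / 5)"
  have \<theta>: "0 < \<theta>" "\<theta> \<le> 1 / 5" "5 * \<theta> \<le> \<delta> / 2" using assms by (auto simp: \<theta>_def)
  obtain n where n: "(1 - \<theta>) ^ n < \<delta> / 2"
    using real_arch_pow_inv[of "\<delta> / 2" "1 - \<theta>"] \<theta> assms by auto
  have pw: "0 \<le> (1 - \<theta>) ^ n" using \<theta> by simp
  have rho: "1 - \<delta> \<le> (1 - 5 * \<theta>) * (1 - (1 - \<theta>) ^ n)"
  proof -
    have "(1 - 5 * \<theta>) * (1 - (1 - \<theta>) ^ n) = 1 - 5 * \<theta> - (1 - \<theta>) ^ n + 5 * \<theta> * (1 - \<theta>) ^ n"
      by (simp add: algebra_simps)
    moreover have "0 \<le> 5 * \<theta> * (1 - \<theta>) ^ n" using \<theta> pw by simp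
    ultimately show ?thesis using n \<theta> by linarith
  qed
  show ?thesis
  proof (intro exI[of _ "2 ^ n * (120 / \<theta> ^ 6)"] conjI allI impI)
    show "0 < 2 ^ n * (120 / \<theta> ^ 6)" using \<theta> by simp
    fix E :: "'e set" and V :: "'e \<Rightarrow> 'x set" and w :: "'e \<Rightarrow> real" and D :: real
    assume H: "linear_hypergraph E V" and D: "2 ^ n * (120 / \<theta> ^ 6) \<le> D"
      and w: "linear_hypergraph.fractional E V w" "\<forall>e\<in>E. w e \<le> 1 / D"
    interpret linear_hypergraph E V by (rule H)
    obtain M where M: "hmatching M" "\<forall>e\<in>M. 0 < w e"
      "(1 - 5 * \<theta>) * (1 - (1 - \<theta>) ^ n) * (\<Sum>e\<in>E. w e) \<le> real (card M)"
      using nibble_ratio_iterate[OF \<theta>(1,2) D] w unfolding nibble_ratio_def by blast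
    have "0 \<le> (\<Sum>e\<in>E. w e)" using w(1) by (auto simp: fractional_def intro: sum_nonneg)
    then have "(1 - \<delta>) * (\<Sum>e\<in>E. w e) \<le> real (card M)"
      using M(3) mult_right_mono[OF rho] by (smt (verit))
    then show "\<exists>M. hmatching M \<and> (\<forall>e\<in>M. 0 < w e) \<and> (1 - \<delta>) * (\<Sum>e\<in>E. w e) \<le> real (card M)"
      using M by blast
  qed
qed

section \<open>Greedy matchings and random reserves\<close>

context linear_hypergraph
begin

lemma card_conflicts:
  assumes "finite Y" "x \<notin> Y"
  shows "card {e \<in> inc x. V e \<inter> Y \<noteq> {}} \<le> card Y"
proof -
  have one: "card {e \<in> inc x. y \<in> V e} \<le> 1" if "y \<in> Y" for y
  proof -
    have "\<forall>e\<in>{e \<in> inc x. y \<in> V e}. \<forall>f\<in>{e \<in> inc x. y \<in> V e}. e = f"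
      using that assms(2) edges_equalI[of _ _ x y] by (auto simp: inc_def)
    then show ?thesis by (simp add: card_le_Suc0_iff_eq)
  qed
  have "{e \<in> inc x. V e \<inter> Y \<noteq> {}} = (\<Union>y\<in>Y. {e \<in> inc x. y \<in> V e})" by auto
  then have "card {e \<in> inc x. V e \<inter> Y \<noteq> {}} \<le> (\<Sum>y\<in>Y. card {e \<in> inc x. y \<in> V e})"
    by (simp only: card_UN_le[OF assms(1)])
  also have "\<dots> \<le> (\<Sum>y\<in>Y. 1)" using one by (rule sum_mono)
  finally show ?thesis by simp
qed

lemma
  assumes "hmatching M"
  shows finite_Union_hmatching: "finite (\<Union>(V ` M))"
    and card_Union_hmatching: "card (\<Union>(V ` M)) \<le> 3 * card M"
proof -
  have M: "finite M" "M \<subseteq> E" using finite_hmatching assms by (auto simp: hmatching_def)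
  then show "finite (\<Union>(V ` M))" using finite_edge by auto
  have "card (\<Union>(V ` M)) \<le> (\<Sum>e\<in>M. card (V e))" by (rule card_UN_le[OF M(1)])
  also have "\<dots> = (\<Sum>e\<in>M. 3)" by (rule sum.cong) (use M card_edge in auto)
  finally show "card (\<Union>(V ` M)) \<le> 3 * card M" by simp
qed

lemma hmatching_insert:
  assumes "hmatching M" "e \<in> E" "V e \<inter> \<Union>(V ` M) = {}"
  shows "hmatching (insert e M)" "e \<notin> M"
proof -
  have "hmatching {e}" using assms(2) by (simp add: hmatching_def)
  moreover have "V f \<inter> V e = {}" if "f \<in> M" for f using assms(3) that by blast
  ultimately show "hmatching (insert e M)" "e \<notin> M"
    using hmatching_Un[OF assms(1), of "{e}"] by auto
qed

text \<open>\<open>M\<close> covers at most \<open>3 * card M\<close> vertices, and by linearity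
  each of them blocks at most one edge at \<open>x\<close>.\<close>

lemma exists_disjoint_edge:
  assumes "hmatching M" "x \<notin> \<Union>(V ` M)" "J \<subseteq> inc x" "3 * card M < card J"
  shows "\<exists>e\<in>J. V e \<inter> \<Union>(V ` M) = {}"
proof (rule ccontr)
  assume "\<not> ?thesis"
  then have "J \<subseteq> {e \<in> inc x. V e \<inter> \<Union>(V ` M) \<noteq> {}}" using assms(3) by blast
  then have "card J \<le> card {e \<in> inc x. V e \<inter> \<Union>(V ` M) \<noteq> {}}" by (intro card_mono) auto
  also have "\<dots> \<le> card (\<Union>(V ` M))"
    by (rule card_conflicts[OF finite_Union_hmatching[OF assms(1)] assms(2)])
  also have "\<dots> \<le> 3 * card M" by (rule card_Union_hmatching[OF assms(1)])
  finally show False using assms(4) by simp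
qed

text \<open>A vertex of degree at least \<open>3 * k\<close> can be set aside: whatever matching of size \<open>k - 1\<close> is found
  without it can be extended at it. Without such vertices the greedy choice succeeds.\<close>

lemma exists_small_hmatching:
  fixes \<Delta> :: real
  assumes "E' \<subseteq> E" "\<And>x. real (card (inc x \<inter> E')) \<le> \<Delta>" "\<Delta> * real k \<le> real (card E')" "9 * real k \<le> \<Delta>"
  shows "\<exists>M\<subseteq>E'. hmatching M \<and> card M = k"
  using assms
proof (induction k arbitrary: E')
  case 0
  have "hmatching {}" by (simp add: hmatching_def)
  then show ?case by (intro exI[of _ "{}"]) simp
next
  case (Suc k)
  have fin: "finite E'" using Suc.prems(1) finite_edges finite_subset by blast
  have \<Delta>: "0 \<le> \<Delta>" "9 * real k \<le> \<Delta>" using Suc.prems(4) by auto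
  show ?case
  proof (cases "\<exists>x. 3 * Suc k \<le> card (inc x \<inter> E')")
    case True
    then obtain x where x: "3 * Suc k \<le> card (inc x \<inter> E')" by blast
    \<comment> \<open>Deleting the star of \<open>x\<close> costs at most \<open>\<Delta>\<close>
      edges, just what lowering \<open>k\<close> by one releases.\<close>
    have "card (E' - inc x) + card (inc x \<inter> E') = card E'"
      using fin card_Diff_subset_Int[of E' "inc x"] card_mono[OF fin, of "inc x \<inter> E'"]
      by (simp add: Int_commute)
    then have "real (card (E' - inc x)) = real (card E') - real (card (inc x \<inter> E'))" by linarith
    then have "\<Delta> * real k \<le> real (card (E' - inc x))"
      using Suc.prems(2)[of x] Suc.prems(3) by (simp add: algebra_simps)
    moreover have "real (card (inc y \<inter> (E' - inc x))) \<le> \<Delta>" for y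
    proof -
      have "card (inc y \<inter> (E' - inc x)) \<le> card (inc y \<inter> E')" by (intro card_mono) auto
      then show ?thesis using Suc.prems(2)[of y] by linarith
    qed
    ultimately obtain M where M: "M \<subseteq> E' - inc x" "hmatching M" "card M = k"
      using Suc.IH[of "E' - inc x"] Suc.prems(1) \<Delta>(2) by blast
    have "x \<notin> \<Union>(V ` M)" using M(1) Suc.prems(1) by (auto simp: inc_def)
    then obtain e where e: "e \<in> inc x \<inter> E'" "V e \<inter> \<Union>(V ` M) = {}"
      using exists_disjoint_edge[OF M(2), of x "inc x \<inter> E'"] x M(3) by auto
    then have "hmatching (insert e M)" "e \<notin> M"
      using hmatching_insert[OF M(2)] Suc.prems(1) by blast+
    then show ?thesis
      using e M finite_hmatching[OF M(2)] by (intro exI[of _ "insert e M"]) auto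
  next
    case False
    then have deg: "card (inc x \<inter> E') \<le> 3 * Suc k" for x by (meson nat_le_linear)
    have "\<Delta> * real k \<le> \<Delta> * real (Suc k)" using \<Delta>(1) by (intro mult_left_mono) auto
    then obtain M where M: "M \<subseteq> E'" "hmatching M" "card M = k"
      using Suc.IH[of E'] Suc.prems \<Delta>(2) by fastforce
    let ?Y = "\<Union>(V ` M)"
    \<comment> \<open>If \<open>M\<close> met every edge, its at most \<open>3 * k\<close> vertices
      of degree at most \<open>3 * Suc k\<close> would leave \<open>E'\<close> with at most
      \<open>9 * k * Suc k\<close> edges, whereas it has at least \<open>\<Delta> * Suc k\<close>
      and \<open>\<Delta> \<ge> 9 * Suc k\<close>.\<close>
    have "\<exists>e\<in>E'. V e \<inter> ?Y = {}"
    proof (rule ccontr)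
      assume "\<not> ?thesis"
      then have "E' \<subseteq> (\<Union>y\<in>?Y. inc y \<inter> E')" using Suc.prems(1) by (fastforce simp: inc_def)
      then have "card E' \<le> card (\<Union>y\<in>?Y. inc y \<inter> E')"
        by (intro card_mono finite_subset[OF _ fin]) blast+
      also have "\<dots> \<le> (\<Sum>y\<in>?Y. card (inc y \<inter> E'))"
        by (rule card_UN_le[OF finite_Union_hmatching[OF M(2)]])
      also have "\<dots> \<le> (\<Sum>y\<in>?Y. 3 * Suc k)" using deg by (intro sum_mono) 
      also have "\<dots> = card ?Y * (3 * Suc k)" by simp
      also have "\<dots> \<le> (3 * k) * (3 * Suc k)"
        using card_Union_hmatching[OF M(2)] M(3) by (intro mult_right_mono) auto
      finally have "real (card E') \<le> real ((3 * k) * (3 * Suc k))" by (simp only: of_nat_le_iff)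
      moreover have "9 * real (Suc k) * real (Suc k) \<le> \<Delta> * real (Suc k)"
        using Suc.prems(4) by (intro mult_right_mono) auto
      ultimately show False using Suc.prems(3) by (simp add: algebra_simps)
    qed
    then obtain e where e: "e \<in> E'" "V e \<inter> ?Y = {}" by blast
    then have "hmatching (insert e M)" "e \<notin> M"
      using hmatching_insert[OF M(2)] Suc.prems(1) by blast+
    then show ?thesis
      using e M finite_hmatching[OF M(2)] by (intro exI[of _ "insert e M"]) auto
  qed
qed

text \<open>Vertices of \<open>X\<close> are matched one at a time. The last hypothesis keeps an
  edge chosen for one of them off the others, so each is still free when its turn comes, and
  \<open>J x\<close> is large enough to leave an unblocked edge.\<close>

lemma extend_hmatching:
  assumes "finite X" "hmatching M" "X \<inter> \<Union>(V ` M) = {}"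
    and "\<And>x. x \<in> X \<Longrightarrow> J x \<subseteq> inc x \<and> 3 * (card M + card X) \<le> card (J x)"
    and "\<And>x e. x \<in> X \<Longrightarrow> e \<in> J x \<Longrightarrow> V e \<inter> X \<subseteq> {x}"
  shows "\<exists>N. hmatching (M \<union> N) \<and> M \<inter> N = {} \<and> card N = card X \<and> X \<subseteq> \<Union>(V ` N) \<and> N \<subseteq> (\<Union>x\<in>X. J x)"
  using assms
proof (induction X rule: finite_induct)
  case empty
  then show ?case by (intro exI[of _ "{}"]) simp
next
  case (insert x X)
  have "\<exists>N. hmatching (M \<union> N) \<and> M \<inter> N = {} \<and> card N = card X \<and> X \<subseteq> \<Union>(V ` N) \<and> N \<subseteq> (\<Union>x\<in>X. J x)"
  proof (rule insert.IH)
    show "X \<inter> \<Union>(V ` M) = {}" using insert.prems(2) by blast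
    fix y assume y: "y \<in> X"
    show "J y \<subseteq> inc y \<and> 3 * (card M + card X) \<le> card (J y)"
      using insert.prems(3)[of y] y insert.hyps by simp
    show "V e \<inter> X \<subseteq> {y}" if "e \<in> J y" for e
      using insert.prems(4)[of y e] y that by blast
  qed (rule insert.prems(1))
  then obtain N where N: "hmatching (M \<union> N)" "M \<inter> N = {}" "card N = card X"
    "X \<subseteq> \<Union>(V ` N)" "N \<subseteq> (\<Union>x\<in>X. J x)" by blast
  have finN: "finite N" "finite M" using finite_hmatching[OF N(1)] by auto
  have "x \<notin> \<Union>(V ` N)"
  proof
    assume "x \<in> \<Union>(V ` N)"
    then obtain e where "e \<in> N" "x \<in> V e" by blast
    moreover from \<open>e \<in> N\<close> obtain y where "y \<in> X" "e \<in> J y" using N(5) by blast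
    ultimately have "x = y" using insert.prems(4)[of y e] by blast
    then show False using \<open>y \<in> X\<close> insert.hyps by simp
  qed
  then have "x \<notin> \<Union>(V ` (M \<union> N))" using insert.prems(2) by blast
  moreover have "3 * card (M \<union> N) < card (J x)"
    using insert.prems(3)[of x] insert.hyps N(2,3) finN by (simp add: card_Un_disjoint)
  moreover have "J x \<subseteq> inc x" using insert.prems(3)[of x] by simp
  ultimately have "\<exists>e\<in>J x. V e \<inter> \<Union>(V ` (M \<union> N)) = {}"
    by (intro exists_disjoint_edge[OF N(1)])
  then obtain e where e: "e \<in> J x" "V e \<inter> \<Union>(V ` (M \<union> N)) = {}" by blast
  have xe: "x \<in> V e" "e \<in> E" using e(1) insert.prems(3)[of x] by (auto simp: inc_def)
  note ins = hmatching_insert[OF N(1) xe(2) e(2)]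
  show ?case
    using ins N e xe insert.hyps finN
    by (intro exI[of _ "insert e N"]) auto
qed

text \<open>Edges at \<open>x\<close> have disjoint remainders off \<open>x\<close> by linearity, so
  the events are pairwise uncorrelated. The predicate \<open>Q\<close> is abstract to cover both
  being contained in the reserve, with \<open>\<nu> = \<mu>\<close>, and avoiding it, with
  \<open>\<nu> = 1 - \<mu>\<close>.\<close>

lemma reserve_deviation:
  fixes Q :: "'x set \<Rightarrow> 'x set \<Rightarrow> bool" and \<nu> :: real
  assumes J: "J \<subseteq> inc x" and \<mu>: "0 \<le> \<mu>" "\<mu> \<le> 1"
    and Q: "\<And>S. S \<subseteq> \<Union>(V ` E) \<Longrightarrow>
      subset_expectation (\<Union>(V ` E)) (\<lambda>_. \<mu>) (\<lambda>R. of_bool (Q S R)) = \<nu> ^ card S"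
    and Un: "\<And>S T R. Q (S \<union> T) R \<longleftrightarrow> Q S R \<and> Q T R"
  shows "subset_expectation (\<Union>(V ` E)) (\<lambda>_. \<mu>)
    (\<lambda>R. (real (card {e \<in> J. Q (V e - {x}) R}) - \<nu>\<^sup>2 * real (card J))\<^sup>2) \<le> real (card J)"
proof -
  let ?U = "\<Union>(V ` E)"
  note U = finite_vertices
  have J': "e \<in> E" "x \<in> V e" if "e \<in> J" for e using that J by (auto simp: inc_def)
  have finJ: "finite J" using J finite_inc finite_subset by blast
  have c2: "card (V e - {x}) = 2" if "e \<in> J" for e using J'[OF that] card_edge by simp
  have "subset_expectation ?U (\<lambda>_. \<mu>) (\<lambda>R. ((\<Sum>e\<in>J. 1 * of_bool (Q (V e - {x}) R)) - (\<Sum>e\<in>J. 1 * \<nu>\<^sup>2))\<^sup>2)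
      \<le> (\<Sum>e\<in>J. 1\<^sup>2) + 0 * (\<Sum>e\<in>J. 1)\<^sup>2"
  proof (rule subset_expectation_square_deviation[OF U _ finJ])
    show "subset_expectation ?U (\<lambda>_. \<mu>) (\<lambda>R. of_bool (Q (V e - {x}) R)) = \<nu>\<^sup>2" if "e \<in> J" for e
      using Q[of "V e - {x}"] J'[OF that] c2[OF that] by auto
    show "subset_expectation ?U (\<lambda>_. \<mu>) (\<lambda>R. of_bool (Q (V e - {x}) R \<and> Q (V f - {x}) R)) \<le> \<nu>\<^sup>2 * \<nu>\<^sup>2 + 0"
      if "e \<in> J" "f \<in> J" "e \<noteq> f" for e f
    proof -
      have "(V e - {x}) \<inter> (V f - {x}) = {}"
        using edges_equalI[of e f x] J' that by blast
      then have "card ((V e - {x}) \<union> (V f - {x})) = 4"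
        using c2 that J' finite_edge by (subst card_Un_disjoint) auto
      moreover have "(V e - {x}) \<union> (V f - {x}) \<subseteq> ?U" using J' that by blast
      ultimately have "subset_expectation ?U (\<lambda>_. \<mu>) (\<lambda>R. of_bool (Q ((V e - {x}) \<union> (V f - {x})) R)) = \<nu> ^ 4"
        using Q by metis
      then show ?thesis by (simp add: Un flip: power_add)
    qed
  qed (use \<mu> in auto)
  moreover have "(\<Sum>e\<in>J. 1 * of_bool (Q (V e - {x}) R)) = real (card {e \<in> J. Q (V e - {x}) R})" for R
    using finJ by (simp add: Int_def)
  ultimately show ?thesis by (simp add: mult.commute)
qed

text \<open>A single \<open>R\<close> keeps the total squared deviation, over both counts and all of
  \<open>F\<close>, at its mean or below. By Markov's inequality few vertices deviate by more than
  \<open>t\<close>; these form \<open>Z\<close>.\<close>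

lemma exists_reserve:
  fixes \<mu> t \<Delta> :: real and F :: "'x set" and J :: "'x \<Rightarrow> 'e set"
  assumes F: "finite F" and J: "\<And>x. x \<in> F \<Longrightarrow> J x \<subseteq> inc x \<and> real (card (J x)) \<le> \<Delta>"
    and \<mu>: "0 \<le> \<mu>" "\<mu> \<le> 1" and t: "0 < t"
  shows "\<exists>R Z. Z \<subseteq> F \<and> t\<^sup>2 * real (card Z) \<le> 2 * \<Delta> * real (card F) \<and> (\<forall>x\<in>F - Z.
    \<mu>\<^sup>2 * real (card (J x)) - t \<le> real (card {e \<in> J x. V e - {x} \<subseteq> R}) \<and>
    \<bar>real (card {e \<in> J x. (V e - {x}) \<inter> R = {}}) - (1 - \<mu>)\<^sup>2 * real (card (J x))\<bar> \<le> t)"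
proof -
  let ?U = "\<Union>(V ` E)"
  let ?Ex = "subset_expectation ?U (\<lambda>_. \<mu>)"
  note U = finite_vertices
  define a where "a x R = real (card {e \<in> J x. V e - {x} \<subseteq> R}) - \<mu>\<^sup>2 * real (card (J x))" for x R
  define b where "b x R = real (card {e \<in> J x. (V e - {x}) \<inter> R = {}}) - (1 - \<mu>)\<^sup>2 * real (card (J x))" for x R
  define G where "G R = (\<Sum>x\<in>F. (a x R)\<^sup>2 + (b x R)\<^sup>2)" for R
  have "?Ex (\<lambda>R. (a x R)\<^sup>2) \<le> \<Delta>" if "x \<in> F" for x
  proof -
    have "?Ex (\<lambda>R. (a x R)\<^sup>2) \<le> real (card (J x))" unfolding a_def
    proof (rule reserve_deviation[where Q = "\<lambda>S R. S \<subseteq> R"])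
      show "?Ex (\<lambda>R. of_bool (S \<subseteq> R)) = \<mu> ^ card S" if "S \<subseteq> ?U" for S
        using subset_expectation_contains[OF U that] by simp
    qed (use J \<open>x \<in> F\<close> \<mu> in auto)
    then show ?thesis using J[OF that] by linarith
  qed
  moreover have "?Ex (\<lambda>R. (b x R)\<^sup>2) \<le> \<Delta>" if "x \<in> F" for x
  proof -
    have "?Ex (\<lambda>R. (b x R)\<^sup>2) \<le> real (card (J x))" unfolding b_def
    proof (rule reserve_deviation[where Q = "\<lambda>S R. S \<inter> R = {}"])
      show "?Ex (\<lambda>R. of_bool (S \<inter> R = {})) = (1 - \<mu>) ^ card S" if "S \<subseteq> ?U" for S
        using subset_expectation_avoids[OF U that] by (simp add: Int_commute)
    qed (use J \<open>x \<in> F\<close> \<mu> in auto)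
    then show ?thesis using J[OF that] by linarith
  qed
  ultimately have "?Ex G \<le> (\<Sum>x\<in>F. \<Delta> + \<Delta>)"
    unfolding G_def subset_expectation_sum subset_expectation_add
    by (intro sum_mono add_mono)
  moreover obtain R where "G R \<le> ?Ex G"
    using exists_le_subset_expectation[OF U, of "\<lambda>_. \<mu>" G] \<mu> by auto
  ultimately have R: "G R \<le> 2 * \<Delta> * real (card F)" by (simp add: algebra_simps)
  define Z where "Z = {x \<in> F. t < \<bar>a x R\<bar> \<or> t < \<bar>b x R\<bar>}"
  have "t\<^sup>2 * real (card Z) = (\<Sum>x\<in>Z. t\<^sup>2)" by simp
  also have "\<dots> \<le> (\<Sum>x\<in>Z. (a x R)\<^sup>2 + (b x R)\<^sup>2)"
  proof (rule sum_mono)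
    fix x assume "x \<in> Z"
    then consider "t \<le> \<bar>a x R\<bar>" | "t \<le> \<bar>b x R\<bar>" by (auto simp: Z_def)
    then show "t\<^sup>2 \<le> (a x R)\<^sup>2 + (b x R)\<^sup>2"
      using t power_mono[of t "\<bar>a x R\<bar>" 2] power_mono[of t "\<bar>b x R\<bar>" 2]
      by cases (auto simp: add_increasing add_increasing2)
  qed
  also have "\<dots> \<le> G R" unfolding G_def by (rule sum_mono2) (use F in \<open>auto simp: Z_def\<close>)
  finally have "t\<^sup>2 * real (card Z) \<le> 2 * \<Delta> * real (card F)" using R by linarith
  moreover have "\<mu>\<^sup>2 * real (card (J x)) - t \<le> real (card {e \<in> J x. V e - {x} \<subseteq> R}) \<and>
      \<bar>real (card {e \<in> J x. (V e - {x}) \<inter> R = {}}) - (1 - \<mu>)\<^sup>2 * real (card (J x))\<bar> \<le> t"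
    if "x \<in> F - Z" for x
    using that by (auto simp: Z_def a_def b_def abs_le_iff)
  moreover have "Z \<subseteq> F" by (auto simp: Z_def)
  ultimately show ?thesis by blast
qed

end

subsection \<open>Hypergraphs with slack away from the full vertices\<close>

text \<open>The constant 400 is set so that a reserve of density \<open>\<gamma> / 2\<close>, which
  keeps about \<open>(\<gamma> / 2)\<^sup>2\<close> of each \<open>J x\<close>, is worth
  \<open>100 * \<sigma> * \<Delta>\<close> edges there. The bound
  \<open>8 / \<sigma> ^ 3 \<le> \<Delta>\<close> keeps the exceptional vertices below
  \<open>\<sigma> * r\<close>. The loss in \<open>nibble\<close> is half of the gain
  \<open>\<gamma>\<^sup>2 * \<sigma>\<close> of the slack case.\<close>

locale full_degree_hypergraph = linear_hypergraph E V for E :: "'e set" and V :: "'e \<Rightarrow> 'x set" +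
  fixes \<gamma> \<Delta> \<sigma> :: real and r :: nat and F :: "'x set" and J :: "'x \<Rightarrow> 'e set"
  defines "\<sigma> \<equiv> \<gamma> ^ 3 / 400"
    and "F \<equiv> {x. (1 - \<gamma>) * \<Delta> < real (card (inc x))}"
    and "J x \<equiv> {e \<in> inc x. V e \<inter> F = {x}}"
  assumes \<gamma>: "0 < \<gamma>" "\<gamma> \<le> 1 / 9"
    and \<Delta>_ge: "8 / \<sigma> ^ 3 \<le> \<Delta>"
    and degree_le: "real (card (inc x)) \<le> \<Delta>"
    and r_le: "real r \<le> \<Delta>"
    and card_E_ge: "\<Delta> * real r \<le> real (card E)"
    and J_ge: "x \<in> F \<Longrightarrow> \<gamma> * \<Delta> \<le> real (card (J x))"
    and nibble: "fractional w \<Longrightarrow> \<forall>e\<in>E. w e \<le> 2 / \<Delta> \<Longrightarrow>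
      \<exists>M. hmatching M \<and> (\<forall>e\<in>M. 0 < w e) \<and> (1 - \<gamma>\<^sup>2 * \<sigma> / 2) * (\<Sum>e\<in>E. w e) \<le> real (card M)"
begin

abbreviation E0 :: "'e set" where "E0 \<equiv> {e \<in> E. V e \<inter> F = {}}"

abbreviation E2 :: "'e set" where "E2 \<equiv> {e \<in> E. 2 \<le> card (V e \<inter> F)}"

lemma \<sigma>: "0 < \<sigma>" "\<sigma> \<le> 1 / 1000" "6 * \<sigma> \<le> \<gamma>" "\<gamma> ^ 3 = 400 * \<sigma>"
proof -
  show "0 < \<sigma>" "\<gamma> ^ 3 = 400 * \<sigma>" using \<gamma> by (auto simp: \<sigma>_def)
  have "\<gamma> * \<gamma>\<^sup>2 \<le> \<gamma> * 1" using \<gamma> by (intro mult_left_mono power_le_one) auto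
  then have "\<gamma> ^ 3 \<le> \<gamma>" by (simp add: power3_eq_cube power2_eq_square)
  then show "\<sigma> \<le> 1 / 1000" "6 * \<sigma> \<le> \<gamma>" using \<gamma> unfolding \<sigma>_def by auto
qed

lemma \<Delta>: "0 < \<Delta>"
  using \<Delta>_ge \<sigma>(1) by (smt (verit) divide_pos_pos zero_less_power)

lemma finite_F: "finite F"
proof (rule finite_subset[OF _ finite_vertices])
  show "F \<subseteq> \<Union>(V ` E)"
  proof
    fix x assume "x \<in> F"
    moreover have "0 < (1 - \<gamma>) * \<Delta>" using \<gamma> \<Delta> by simp
    ultimately have "0 < real (card (inc x))" by (simp add: F_def)
    then have "inc x \<noteq> {}" by auto
    then show "x \<in> \<Union>(V ` E)" by (auto simp: inc_def)
  qed
qed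

lemma J_subset: "J x \<subseteq> inc x"
  by (auto simp: J_def)

lemma finite_J [simp]: "finite (J x)"
  using J_subset finite_inc finite_subset by blast

lemma card_J_le: "real (card (J x)) \<le> \<Delta>"
proof -
  have "card (J x) \<le> card (inc x)" by (intro card_mono J_subset) simp
  then show ?thesis using degree_le[of x] by linarith
qed

lemma card_J_pos: "x \<in> F \<Longrightarrow> 0 < card (J x)"
  using J_ge[of x] \<gamma> \<Delta> by (smt (verit) mult_pos_pos of_nat_0_less_iff)

lemma degree_low: "x \<notin> F \<Longrightarrow> real (card (inc x)) \<le> (1 - \<gamma>) * \<Delta>"
  by (simp add: F_def)

lemma inc_diff_J: "x \<in> F \<Longrightarrow> inc x - J x = {e \<in> inc x. e \<in> E2}"
proof -
  assume x: "x \<in> F"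
  have "V e \<inter> F \<noteq> {x} \<longleftrightarrow> 2 \<le> card (V e \<inter> F)" if "e \<in> inc x" for e
  proof
    assume ne: "V e \<inter> F \<noteq> {x}"
    have "x \<in> V e \<inter> F" using that x by (simp add: inc_def)
    then obtain y where "y \<in> V e \<inter> F" "y \<noteq> x" using ne by blast
    then have "{x, y} \<subseteq> V e \<inter> F" "card {x, y} = 2" using \<open>x \<in> V e \<inter> F\<close> by auto
    then show "2 \<le> card (V e \<inter> F)" using finite_F by (metis card_mono finite_Int)
  qed auto
  then show ?thesis by (auto simp: J_def inc_def)
qed

lemma edge_cases:
  assumes "e \<in> E"
  obtains "e \<in> E0" | x where "x \<in> F" "e \<in> J x" "V e \<inter> F = {x}" | "e \<in> E2"
proof (cases "V e \<inter> F = {}")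
  case True
  then show thesis using that(1) assms by simp
next
  case False
  then obtain x where x: "x \<in> V e" "x \<in> F" by blast
  then have "e \<in> inc x" using assms by (simp add: inc_def)
  then show thesis
    using that(2)[of x] that(3) inc_diff_J[OF x(2)] x(2) by (cases "e \<in> J x") (auto simp: J_def)
qed

lemma sum_J: "(\<Sum>x\<in>F. \<Sum>e\<in>J x. g x) = (\<Sum>e\<in>E. \<Sum>x\<in>V e \<inter> F. of_bool (e \<in> J x) * (g x :: real))"
proof -
  have "(\<Sum>e\<in>J x. g x) = (\<Sum>e\<in>inc x. of_bool (e \<in> J x) * g x)" for x
    using J_subset[of x] by (simp add: Int_absorb1 flip: sum_distrib_right)
  then show ?thesis by (simp only: sum_inc_Int[OF finite_F])
qed

lemma sum_non_J_ge: "2 * real (card E2) \<le> (\<Sum>x\<in>F. real (card (inc x - J x)))"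
proof -
  have "2 * real (card E2) = (\<Sum>e\<in>E. 2 * of_bool (e \<in> E2))"
    using finite_edges by (simp add: Int_def flip: sum_distrib_left)
  also have "\<dots> \<le> (\<Sum>e\<in>E. \<Sum>x\<in>V e \<inter> F. of_bool (e \<in> E2))"
    by (intro sum_mono) auto
  also have "\<dots> = (\<Sum>x\<in>F. \<Sum>e\<in>inc x. of_bool (e \<in> E2))"
    by (rule sum_inc_Int[OF finite_F, symmetric])
  also have "\<dots> = (\<Sum>x\<in>F. real (card (inc x - J x)))"
    by (rule sum.cong) (simp_all add: inc_diff_J Int_def)
  finally show ?thesis .
qed

text \<open>The weight \<open>1 / \<Delta>\<close> is raised on the edges of \<open>E0\<close> and lowered on those of \<open>E2\<close>; every full vertex
  passes what it loses to its edges in \<open>J x\<close>, whose other two vertices can afford it. Edges in \<open>E2\<close> are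
  compensated at least twice.\<close>

definition gain :: "'e \<Rightarrow> real" where
  "gain e = \<gamma> * of_bool (e \<in> E0) - \<gamma>\<^sup>2 * of_bool (e \<in> E2)
    + \<gamma>\<^sup>2 * (\<Sum>x\<in>V e \<inter> F. of_bool (e \<in> J x) * (real (card (inc x - J x)) / real (card (J x))))"

lemma gain_E0: "e \<in> E0 \<Longrightarrow> gain e = \<gamma>"
  by (auto simp: gain_def)

lemma gain_J: "x \<in> F \<Longrightarrow> e \<in> J x \<Longrightarrow> gain e = \<gamma>\<^sup>2 * (real (card (inc x - J x)) / real (card (J x)))"
  by (auto simp: gain_def J_def)

lemma gain_E2: "e \<in> E2 \<Longrightarrow> gain e = - \<gamma>\<^sup>2"
  by (auto simp: gain_def J_def intro!: sum.neutral)

text \<open>On \<open>J x\<close> the upper bound comes from \<open>J_ge\<close>: the losses of at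
  most \<open>\<Delta>\<close> edges are shared by at least \<open>\<gamma> * \<Delta>\<close>
  edges, which turns \<open>\<gamma>\<^sup>2\<close> into at most \<open>\<gamma>\<close>.\<close>

lemma gain_bounds:
  assumes "e \<in> E"
  shows "- 1 \<le> gain e" "gain e \<le> \<gamma>"
proof -
  have sq: "\<gamma>\<^sup>2 \<le> 1" "- \<gamma>\<^sup>2 \<le> \<gamma>"
    using \<gamma> zero_le_power2[of \<gamma>] by (simp add: power_le_one, linarith)
  have "- 1 \<le> gain e \<and> gain e \<le> \<gamma>"
    using assms
  proof (cases rule: edge_cases)
    case (2 x)
    have "real (card (inc x - J x)) \<le> \<Delta>"
      using card_mono[OF finite_inc, of "inc x - J x" x] degree_le[of x] by fastforce
    then have "\<gamma> * real (card (inc x - J x)) \<le> real (card (J x))"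
      using J_ge[OF 2(1)] mult_left_mono[of "real (card (inc x - J x))" \<Delta> \<gamma>] \<gamma> by linarith
    then have "\<gamma> * (real (card (inc x - J x)) / real (card (J x))) \<le> 1"
      using card_J_pos[OF 2(1)] by simp
    then have "\<gamma> * (\<gamma> * (real (card (inc x - J x)) / real (card (J x)))) \<le> \<gamma> * 1"
      using \<gamma> by (intro mult_left_mono) auto
    then have "gain e \<le> \<gamma>" unfolding gain_J[OF 2(1,2)] by (simp only: power2_eq_square mult.assoc mult_1_right)
    moreover have "0 \<le> gain e" unfolding gain_J[OF 2(1,2)] by simp
    ultimately show ?thesis by simp
  qed (use gain_E0 gain_E2 sq \<gamma> in auto)
  then show "- 1 \<le> gain e" "gain e \<le> \<gamma>" by auto
qed

lemma sum_gain_full: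
  assumes x: "x \<in> F"
  shows "(\<Sum>e\<in>inc x. gain e) = 0"
proof -
  have "(\<Sum>e\<in>inc x. gain e) = (\<Sum>e\<in>inc x - J x. gain e) + (\<Sum>e\<in>J x. gain e)"
    by (rule sum.subset_diff[OF J_subset finite_inc])
  also have "(\<Sum>e\<in>inc x - J x. gain e) = (\<Sum>e\<in>inc x - J x. - \<gamma>\<^sup>2)"
    by (rule sum.cong[OF refl]) (use inc_diff_J[OF x] gain_E2 in blast)
  also have "(\<Sum>e\<in>J x. gain e) = (\<Sum>e\<in>J x. \<gamma>\<^sup>2 * (real (card (inc x - J x)) / real (card (J x))))"
    by (rule sum.cong[OF refl]) (rule gain_J[OF x])
  finally show ?thesis using card_J_pos[OF x] by (auto simp: mult.commute)
qed

lemma sum_gain_ge: "\<gamma> * real (card E0) + \<gamma>\<^sup>2 * real (card E2) \<le> (\<Sum>e\<in>E. gain e)"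
proof -
  have "(\<Sum>e\<in>E. \<Sum>x\<in>V e \<inter> F. of_bool (e \<in> J x) * (real (card (inc x - J x)) / real (card (J x))))
      = (\<Sum>x\<in>F. \<Sum>e\<in>J x. real (card (inc x - J x)) / real (card (J x)))"
    by (rule sum_J[symmetric])
  also have "\<dots> = (\<Sum>x\<in>F. real (card (inc x - J x)))"
    by (rule sum.cong[OF refl]) (use card_J_pos in fastforce)
  also have "\<dots> \<ge> 2 * real (card E2)" by (rule sum_non_J_ge)
  finally have "\<gamma>\<^sup>2 * (2 * real (card E2)) \<le> \<gamma>\<^sup>2 *
      (\<Sum>e\<in>E. \<Sum>x\<in>V e \<inter> F. of_bool (e \<in> J x) * (real (card (inc x - J x)) / real (card (J x))))"
    by (intro mult_left_mono) auto
  moreover have "(\<Sum>e\<in>E. \<gamma> * of_bool (e \<in> E0)) = \<gamma> * real (card E0)"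
    "(\<Sum>e\<in>E. \<gamma>\<^sup>2 * of_bool (e \<in> E2)) = \<gamma>\<^sup>2 * real (card E2)"
    using finite_edges by (simp_all add: Int_def flip: sum_distrib_left)
  ultimately show ?thesis
    unfolding gain_def sum.distrib sum_subtractf by (simp add: sum_distrib_left)
qed

text \<open>The weight \<open>(1 + gain e) / \<Delta>\<close> stays fractional: at full vertices the
  gains cancel, elsewhere \<open>(1 - \<gamma>) * (1 + \<gamma>) \<le> 1\<close>. With
  \<open>\<eta> = \<gamma>\<^sup>2 * \<sigma>\<close> its size is at least
  \<open>(1 + \<eta>) * r\<close>, and \<open>(1 - \<eta> / 2) * (1 + \<eta>) \<ge> 1\<close>
  absorbs the nibble loss.\<close>

lemma exists_hmatching_of_slack:
  assumes "(1 + \<gamma>\<^sup>2 * \<sigma>) * (\<Delta> * real r) \<le> real (card E) + \<gamma> * real (card E0) + \<gamma>\<^sup>2 * real (card E2)"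
  shows "\<exists>M. hmatching M \<and> r \<le> card M"
proof -
  define w where "w e = (1 + gain e) / \<Delta>" for e
  have "fractional w"
    unfolding fractional_def
  proof (intro conjI ballI allI)
    show "0 \<le> w e" if "e \<in> E" for e using gain_bounds(1)[OF that] \<Delta> by (simp add: w_def)
    fix x
    have "(\<Sum>e\<in>inc x. 1 + gain e) \<le> \<Delta>"
    proof (cases "x \<in> F")
      case True
      then show ?thesis using sum_gain_full degree_le by (simp add: sum.distrib)
    next
      case False
      have "(\<Sum>e\<in>inc x. 1 + gain e) \<le> (\<Sum>e\<in>inc x. 1 + \<gamma>)"
        by (intro sum_mono) (use gain_bounds inc_subset in auto)
      also have "\<dots> = real (card (inc x)) * (1 + \<gamma>)" by simp
      also have "\<dots> \<le> (1 - \<gamma>) * \<Delta> * (1 + \<gamma>)"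
        using degree_low[OF False] \<gamma> by (intro mult_right_mono) auto
      also have "\<dots> = \<Delta> - \<gamma> * \<gamma> * \<Delta>" by (simp add: algebra_simps)
      also have "\<dots> \<le> \<Delta>" using \<Delta> by simp
      finally show ?thesis .
    qed
    then show "(\<Sum>e\<in>inc x. w e) \<le> 1" using \<Delta> by (simp add: w_def flip: sum_divide_distrib)
  qed
  moreover have "\<forall>e\<in>E. w e \<le> 2 / \<Delta>"
    unfolding w_def using gain_bounds(2) \<gamma> \<Delta> by (intro ballI divide_right_mono) fastforce+
  ultimately obtain M where M: "hmatching M" "(1 - \<gamma>\<^sup>2 * \<sigma> / 2) * (\<Sum>e\<in>E. w e) \<le> real (card M)"
    using nibble by blast
  let ?\<eta> = "\<gamma>\<^sup>2 * \<sigma>"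
  have \<eta>: "0 \<le> ?\<eta>" "?\<eta> \<le> 1" using \<sigma> \<gamma> by (auto intro!: mult_le_one power_le_one)
  have "(1 + ?\<eta>) * (\<Delta> * real r) \<le> (\<Sum>e\<in>E. 1 + gain e)"
    using assms sum_gain_ge by (simp add: sum.distrib)
  also have "\<dots> = \<Delta> * (\<Sum>e\<in>E. w e)" using \<Delta> by (simp add: w_def flip: sum_divide_distrib)
  finally have "(1 + ?\<eta>) * real r \<le> (\<Sum>e\<in>E. w e)" using \<Delta> by (simp add: mult.left_commute)
  then have "(1 - ?\<eta> / 2) * ((1 + ?\<eta>) * real r) \<le> real (card M)"
    using M(2) \<eta> mult_left_mono[of "(1 + ?\<eta>) * real r" "\<Sum>e\<in>E. w e" "1 - ?\<eta> / 2"] by linarith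
  moreover have "1 * real r \<le> (1 - ?\<eta> / 2) * (1 + ?\<eta>) * real r"
  proof (rule mult_right_mono)
    have "?\<eta> * ?\<eta> \<le> ?\<eta> * 1" using \<eta> by (intro mult_left_mono)
    then show "1 \<le> (1 - ?\<eta> / 2) * (1 + ?\<eta>)" by (simp add: algebra_simps)
  qed simp
  ultimately show ?thesis using M(1) by (auto simp: mult.assoc)
qed

end

section \<open>The tight case: almost every edge has exactly one full vertex\<close>

locale tight_hypergraph = full_degree_hypergraph E V \<gamma> \<Delta> \<sigma> r F J
  for E :: "'e set" and V :: "'e \<Rightarrow> 'x set" and \<gamma> \<Delta> \<sigma> r F J +
  assumes tight: "real (card E) + \<gamma> * real (card {e \<in> E. V e \<inter> F = {}})
      + \<gamma>\<^sup>2 * real (card {e \<in> E. 2 \<le> card (V e \<inter> F)}) < (1 + \<gamma>\<^sup>2 * \<sigma>) * (\<Delta> * real r)"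
begin

lemma card_E0_le: "real (card E0) \<le> \<sigma> * (\<Delta> * real r)"
  and card_E2_le: "real (card E2) \<le> \<sigma> * (\<Delta> * real r)"
  and card_E_le: "real (card E) \<le> (1 + \<sigma>) * (\<Delta> * real r)"
proof -
  let ?D = "\<Delta> * real r"
  have D: "0 \<le> ?D" using \<Delta> by simp
  have g2: "\<gamma>\<^sup>2 \<le> 1" "0 < \<gamma>\<^sup>2" using \<gamma> by (auto simp: power_le_one)
  have nn: "0 \<le> \<gamma> * real (card E0)" "0 \<le> \<gamma>\<^sup>2 * real (card E2)" using \<gamma> by auto
  have t: "real (card E) + \<gamma> * real (card E0) + \<gamma>\<^sup>2 * real (card E2) < ?D + \<gamma>\<^sup>2 * (\<sigma> * ?D)"
    using tight by (simp add: algebra_simps)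
  have "\<gamma>\<^sup>2 * real (card E2) \<le> \<gamma>\<^sup>2 * (\<sigma> * ?D)" using t nn(1) card_E_ge by linarith
  then show "real (card E2) \<le> \<sigma> * ?D" using g2 by (simp only: mult_le_cancel_left_pos)
  have gg: "\<gamma> * (\<sigma> * ?D) \<le> 1 * (\<sigma> * ?D)" using \<gamma> \<sigma> D by (intro mult_right_mono) auto
  have "\<gamma> * real (card E0) \<le> \<gamma> * (\<gamma> * (\<sigma> * ?D))"
  proof -
    have "\<gamma>\<^sup>2 * (\<sigma> * ?D) = \<gamma> * (\<gamma> * (\<sigma> * ?D))" by (simp add: power2_eq_square)
    then show ?thesis using t nn(2) card_E_ge by linarith
  qed
  then have "real (card E0) \<le> \<gamma> * (\<sigma> * ?D)" using \<gamma> by (simp only: mult_le_cancel_left_pos)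
  then show "real (card E0) \<le> \<sigma> * ?D" using gg by linarith
  have "\<gamma>\<^sup>2 * (\<sigma> * ?D) \<le> 1 * (\<sigma> * ?D)" using g2 \<sigma> D by (intro mult_right_mono) auto
  then show "real (card E) \<le> (1 + \<sigma>) * ?D" unfolding distrib_right using t nn by linarith
qed

text \<open>Degrees in \<open>F\<close> exceed \<open>8 / 9 * \<Delta>\<close> and add up to at most
  three times the number of edges; 4 is a rounded constant.\<close>

lemma card_F_le: "real (card F) \<le> 4 * real r"
proof -
  have "\<Delta> * (8 / 9 * real (card F)) \<le> (\<Sum>x\<in>F. (1 - \<gamma>) * \<Delta>)"
    using mult_right_mono[of "8 / 9" "1 - \<gamma>" "\<Delta> * real (card F)"] \<gamma> \<Delta> by (simp add: mult_ac)
  also have "\<dots> \<le> (\<Sum>x\<in>F. real (card (inc x)))"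
    by (rule sum_mono) (simp add: F_def)
  also have "\<dots> = (\<Sum>x\<in>F. \<Sum>e\<in>inc x. 1 :: real)" by simp
  also have "\<dots> = (\<Sum>e\<in>E. real (card (V e \<inter> F)))" unfolding sum_inc_Int[OF finite_F] by simp
  also have "\<dots> \<le> (\<Sum>e\<in>E. 3)"
  proof (rule sum_mono)
    fix e assume "e \<in> E"
    then have "card (V e \<inter> F) \<le> 3" using card_mono[OF finite_edge, of e "V e \<inter> F"] card_edge by auto
    then show "real (card (V e \<inter> F)) \<le> 3" by simp
  qed
  also have "\<dots> = 3 * real (card E)" by simp
  also have "\<dots> \<le> 3 * ((1 + \<sigma>) * (\<Delta> * real r))" using card_E_le by simp
  also have "\<dots> \<le> 3 * ((1 + 1 / 1000) * (\<Delta> * real r))"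
    using \<sigma> \<Delta> by (intro mult_left_mono mult_right_mono add_left_mono) auto
  also have "\<dots> = \<Delta> * (3003 / 1000 * real r)" by simp
  finally have "8 / 9 * real (card F) \<le> 3003 / 1000 * real r" using \<Delta> by (simp only: mult_le_cancel_left_pos)
  then show ?thesis by simp
qed

lemma card_E_split: "real (card E) = real (card E0) + (\<Sum>x\<in>F. real (card (J x))) + real (card E2)"
proof -
  have "real (card E) = (\<Sum>e\<in>E. 1)" by simp
  also have "\<dots> = (\<Sum>e\<in>E. of_bool (e \<in> E0) + (\<Sum>x\<in>V e \<inter> F. of_bool (e \<in> J x) * 1) + of_bool (e \<in> E2))"
  proof (rule sum.cong[OF refl])
    fix e assume "e \<in> E"
    then show "1 = of_bool (e \<in> E0) + (\<Sum>x\<in>V e \<inter> F. of_bool (e \<in> J x) * 1) + (of_bool (e \<in> E2) :: real)"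
    proof (cases rule: edge_cases)
      case 3
      then have "e \<notin> J x" for x by (auto simp: J_def)
      then show ?thesis using 3 by (auto simp del: sum_eq_0_iff)
    qed auto
  qed
  also have "\<dots> = real (card E0) + (\<Sum>x\<in>F. \<Sum>e\<in>J x. 1) + real (card E2)"
    unfolding sum_J sum.distrib using finite_edges by (simp add: Int_def)
  finally show ?thesis by simp
qed

lemma sum_card_J_ge: "(1 - 2 * \<sigma>) * (\<Delta> * real r) \<le> (\<Sum>x\<in>F. real (card (J x)))"
  using card_E_split card_E_ge card_E0_le card_E2_le by (simp add: algebra_simps)

text \<open>Edges outside \<open>E0\<close> meet \<open>F\<close>, so there are at most
  \<open>\<Delta> * card F\<close> of them. If \<open>F\<close> is too small to supply
  \<open>r\<close> edges, the deficit is thus available in \<open>E0\<close>; truncated subtraction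
  covers the other case.\<close>

lemma card_E0_ge: "\<Delta> * real (r - card F) \<le> real (card E0)"
proof (cases "card F \<le> r")
  case True
  have "(\<Sum>x\<in>F. real (card (inc x))) = (\<Sum>x\<in>F. real (card (J x)) + real (card (inc x - J x)))"
    by (intro sum.cong refl) (use J_subset finite_J in \<open>simp add: card_Diff_subset of_nat_diff card_mono\<close>)
  then have "(\<Sum>x\<in>F. real (card (inc x))) \<ge> real (card E) - real (card E0)"
    using card_E_split sum_non_J_ge by (simp add: sum.distrib)
  moreover have "(\<Sum>x\<in>F. real (card (inc x))) \<le> (\<Sum>x\<in>F. \<Delta>)" by (intro sum_mono degree_le)
  ultimately show ?thesis using card_E_ge True by (simp add: of_nat_diff algebra_simps)
qed simp

text \<open>The deficit \<open>r - card F\<close> is taken from \<open>E0\<close>, then each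
  exceptional vertex of \<open>Z\<close> gets an edge of its own \<open>J x\<close>. No other full
  vertex is used up.\<close>

lemma exists_initial_hmatching:
  fixes Z :: "'x set"
  assumes "Z \<subseteq> F" "real (card Z) \<le> \<sigma> * real r"
  obtains M where "hmatching M" "card M = (r - card F) + card Z" "\<Union>(V ` M) \<inter> F = Z"
    "real (card M) \<le> 2 * \<sigma> * real r"
proof -
  define k where "k = r - card F"
  have E0_ge: "\<Delta> * real k \<le> real (card E0)" using card_E0_ge by (simp add: k_def)
  then have "\<Delta> * real k \<le> \<Delta> * (\<sigma> * real r)" using card_E0_le by (simp add: mult_ac)
  then have k: "real k \<le> \<sigma> * real r" using \<Delta> by (simp only: mult_le_cancel_left_pos)
  have sr: "\<sigma> * real r \<le> \<sigma> * \<Delta>" using r_le \<sigma> by (intro mult_left_mono) auto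
  have "\<exists>M\<subseteq>E0. hmatching M \<and> card M = k"
  proof (rule exists_small_hmatching[of _ \<Delta>])
    show "real (card (inc x \<inter> E0)) \<le> \<Delta>" for x
      using card_mono[OF finite_inc, of "inc x \<inter> E0" x] degree_le[of x] by fastforce
    have "9 * (\<sigma> * \<Delta>) \<le> 1 * \<Delta>" using \<sigma>(1,2) \<Delta> mult_right_mono[of "9 * \<sigma>" 1 \<Delta>] by simp
    then show "9 * real k \<le> \<Delta>" using k sr by linarith
  qed (use E0_ge in auto)
  then obtain M where M: "M \<subseteq> E0" "hmatching M" "card M = k" by blast
  have finZ: "finite Z" using finite_F assms(1) finite_subset by blast
  have "\<exists>N. hmatching (M \<union> N) \<and> M \<inter> N = {} \<and> card N = card Z \<and> Z \<subseteq> \<Union>(V ` N) \<and> N \<subseteq> (\<Union>x\<in>Z. J x)"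
  proof (rule extend_hmatching[OF finZ M(2)])
    show "Z \<inter> \<Union>(V ` M) = {}" using M(1) assms(1) by blast
    show "J x \<subseteq> inc x \<and> 3 * (card M + card Z) \<le> card (J x)" if "x \<in> Z" for x
    proof -
      have "6 * (\<sigma> * \<Delta>) \<le> \<gamma> * \<Delta>"
        using mult_right_mono[OF \<sigma>(3), of \<Delta>] \<Delta> by (simp add: mult.assoc)
      moreover have "real k \<le> \<sigma> * \<Delta>" "real (card Z) \<le> \<sigma> * \<Delta>" using k assms(2) sr by auto
      ultimately have "3 * (real k + real (card Z)) \<le> \<gamma> * \<Delta>" by argo
      also have "\<dots> \<le> real (card (J x))" using J_ge assms(1) that by blast
      finally show ?thesis using M(3) J_subset by auto
    qed
    show "V e \<inter> Z \<subseteq> {x}" if "e \<in> J x" for e x using that assms(1) by (auto simp: J_def)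
  qed
  then obtain N where N: "hmatching (M \<union> N)" "M \<inter> N = {}" "card N = card Z" "Z \<subseteq> \<Union>(V ` N)"
    "N \<subseteq> (\<Union>x\<in>Z. J x)" by blast
  have card: "card (M \<union> N) = k + card Z"
    using N(1,2,3) M(3) finite_hmatching[OF N(1)] by (simp add: card_Un_disjoint)
  have "V e \<inter> F \<subseteq> Z" if e: "e \<in> M \<union> N" for e
  proof (cases "e \<in> M")
    case False
    then obtain x where "x \<in> Z" "e \<in> J x" using e N(5) by blast
    then show ?thesis by (auto simp: J_def)
  qed (use M(1) in blast)
  then have "\<Union>(V ` (M \<union> N)) \<inter> F \<subseteq> Z" by blast
  moreover have "Z \<subseteq> \<Union>(V ` (M \<union> N)) \<inter> F"
    using N(4) assms(1) by (simp add: le_supI2)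
  ultimately have "\<Union>(V ` (M \<union> N)) \<inter> F = Z" by (rule equalityI)
  moreover have "real (card (M \<union> N)) \<le> 2 * \<sigma> * real r" using card k assms(2) by simp
  ultimately show thesis using that N(1) card by (simp add: k_def)
qed

text \<open>The edges at \<open>x\<close> open to the main matching. The reserve may contain
  \<open>x\<close> itself, so only the other two vertices have to avoid it.\<close>

definition available :: "'x set \<Rightarrow> 'x \<Rightarrow> 'e set" where
  "available R x = {e \<in> J x. (V e - {x}) \<inter> R = {}}"

lemma exists_main_hmatching:
  fixes R Z Y :: "'x set"
  assumes Z: "Z \<subseteq> F" "real (card Z) \<le> \<sigma> * real r"
    and Y: "finite Y" "Y \<inter> F = Z" "real (card Y) \<le> 6 * \<sigma> * real r"
    and R: "\<And>x. x \<in> F - Z \<Longrightarrow>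
      \<bar>real (card (available R x)) - (1 - \<gamma> / 2)\<^sup>2 * real (card (J x))\<bar> \<le> \<sigma> * \<Delta>"
  obtains M where "hmatching M" "(1 - 29 * \<sigma>) * real r \<le> real (card M)"
    "M \<subseteq> (\<Union>x\<in>F - Z. available R x)" "\<Union>(V ` M) \<inter> Y = {}"
proof -
  define m where "m = (1 - \<gamma> / 2)\<^sup>2"
  \<comment> \<open>\<open>D\<close> bounds all degrees in \<open>S\<close>: at full vertices
    because available edges number at most \<open>(m + \<sigma>) * \<Delta>\<close>, elsewhere
    because \<open>m \<ge> 1 - \<gamma>\<close>. The density \<open>\<gamma> / 2\<close> of the
    reserve is what makes the latter hold.\<close>
  define D where "D = (m + \<sigma>) * \<Delta>"
  have m: "1 - \<gamma> \<le> m" "8 / 9 \<le> m" "m \<le> 1"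
  proof -
    have "m = 1 - \<gamma> + (\<gamma> / 2)\<^sup>2" by (simp add: m_def power2_eq_square field_simps)
    then show "1 - \<gamma> \<le> m" by simp
    then show "8 / 9 \<le> m" using \<gamma> by linarith
    show "m \<le> 1" using \<gamma> unfolding m_def by (intro power_le_one) auto
  qed
  have sub_E: "available R x \<subseteq> E" "finite (available R x)" for x
    using J_subset inc_subset finite_J by (auto simp: available_def)
  define S where "S = {e \<in> (\<Union>x\<in>F - Z. available R x). V e \<inter> Y = {}}"
  have SE: "S \<subseteq> E" using sub_E by (auto simp: S_def)
  have D: "0 < D" "\<Delta> / 2 \<le> D"
    using m \<sigma>(1) \<Delta> mult_right_mono[of "1 / 2" "m + \<sigma>" \<Delta>] by (auto simp: D_def)
  have deg: "real (card (inc x \<inter> S)) \<le> D" for x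
  proof (cases "x \<in> F")
    case False
    have "real (card (inc x \<inter> S)) \<le> real (card (inc x))" by (simp add: card_mono)
    also have "\<dots> \<le> (1 - \<gamma>) * \<Delta>" by (rule degree_low[OF False])
    also have "\<dots> \<le> D" using m \<sigma> \<Delta> unfolding D_def by (intro mult_right_mono) auto
    finally show ?thesis .
  next
    case x: True
    have "x \<in> F - Z \<and> e \<in> available R x" if e: "e \<in> inc x \<inter> S" for e
    proof -
      from e obtain y where y: "y \<in> F - Z" "e \<in> available R y" by (auto simp: S_def)
      then have "V e \<inter> F = {y}" by (simp add: available_def J_def)
      moreover have "x \<in> V e" using e by (simp add: inc_def)
      ultimately have "x = y" using x by blast
      then show ?thesis using y by simp
    qed
    then have sub: "inc x \<inter> S \<subseteq> available R x" and "inc x \<inter> S = {} \<or> x \<in> F - Z" by blast+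
    then consider "inc x \<inter> S = {}" | "x \<in> F - Z" by blast
    then show ?thesis
    proof cases
      case 1
      then show ?thesis using D(1) by simp
    next
      case 2
      have "real (card (inc x \<inter> S)) \<le> real (card (available R x))" by (simp add: card_mono sub sub_E)
      also have "\<dots> \<le> m * real (card (J x)) + \<sigma> * \<Delta>" using R[OF 2] by (simp add: m_def abs_le_iff)
      also have "\<dots> \<le> m * \<Delta> + \<sigma> * \<Delta>" using card_J_le[of x] m by (intro add_right_mono mult_left_mono) auto
      finally show ?thesis by (simp add: D_def algebra_simps)
    qed
  qed
  define w where "w e = of_bool (e \<in> S) / D" for e
  have sum_w: "(\<Sum>e\<in>A. w e) = real (card (A \<inter> S)) / D" if "finite A" for A
    using that by (simp add: w_def Int_def flip: sum_divide_distrib)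
  have "fractional w" unfolding fractional_def
    using deg D(1) by (simp add: sum_w) (simp add: w_def)
  moreover have "\<forall>e\<in>E. w e \<le> 2 / \<Delta>"
  proof
    fix e
    have "w e \<le> 1 / D" using D(1) by (simp add: w_def divide_right_mono)
    also have "\<dots> \<le> 1 / (\<Delta> / 2)" using D \<Delta> by (intro divide_left_mono) auto
    finally show "w e \<le> 2 / \<Delta>" by simp
  qed
  ultimately obtain M where M: "hmatching M" "\<forall>e\<in>M. 0 < w e"
    "(1 - \<gamma>\<^sup>2 * \<sigma> / 2) * (\<Sum>e\<in>E. w e) \<le> real (card M)"
    using nibble by blast
  have MS: "M \<subseteq> S" using M(2) D(1) by (auto simp: w_def zero_less_divide_iff of_bool_def split: if_splits)
  \<comment> \<open>The 13 collects 2 for edges outside all \<open>J x\<close>, 1 for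
    \<open>Z\<close>, 4 for the deviations over at most \<open>4 * r\<close> full vertices and 6 for
    edges meeting \<open>Y\<close>.\<close>
  have "real r * (m - 13 * \<sigma>) * \<Delta> \<le> real (card S)"
  proof -
    let ?T = "\<Union>x\<in>F - Z. available R x"
    let ?C = "{e \<in> E. V e \<inter> Y \<noteq> {}}"
    have "?T \<subseteq> S \<union> ?C" using sub_E by (auto simp: S_def)
    then have "card ?T \<le> card (S \<union> ?C)"
      using finite_subset[OF SE finite_edges] finite_edges by (intro card_mono) auto
    also have "\<dots> \<le> card S + card ?C" by (rule card_Un_le)
    finally have T_le: "real (card ?T) \<le> real (card S) + real (card ?C)" by linarith
    have "?C \<subseteq> (\<Union>y\<in>Y. inc y)" by (auto simp: inc_def)
    then have "card ?C \<le> card (\<Union>y\<in>Y. inc y)" using Y(1) by (intro card_mono) auto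
    also have "\<dots> \<le> (\<Sum>y\<in>Y. card (inc y))" by (rule card_UN_le[OF Y(1)])
    finally have "real (card ?C) \<le> (\<Sum>y\<in>Y. real (card (inc y)))" by (simp flip: of_nat_sum)
    also have "\<dots> \<le> (\<Sum>y\<in>Y. \<Delta>)" by (intro sum_mono degree_le)
    also have "\<dots> = real (card Y) * \<Delta>" by simp
    also have "\<dots> \<le> 6 * \<sigma> * real r * \<Delta>" using Y(3) \<Delta> by (intro mult_right_mono) auto
    finally have C_le: "real (card ?C) \<le> 6 * \<sigma> * real r * \<Delta>" .
    have finFZ: "finite (F - Z)" using finite_F by simp
    have "card ?T = (\<Sum>x\<in>F - Z. card (available R x))"
      by (rule card_UN_disjoint[OF finFZ]) (use sub_E in \<open>auto simp: available_def J_def\<close>)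
    then have "real (card ?T) = (\<Sum>x\<in>F - Z. real (card (available R x)))" by simp
    also have "\<dots> \<ge> (\<Sum>x\<in>F - Z. m * real (card (J x)) - \<sigma> * \<Delta>)"
    proof (rule sum_mono)
      fix x assume "x \<in> F - Z"
      then show "m * real (card (J x)) - \<sigma> * \<Delta> \<le> real (card (available R x))"
        using R[of x] unfolding m_def by linarith
    qed
    finally have T_ge: "m * (\<Sum>x\<in>F - Z. real (card (J x))) - real (card (F - Z)) * (\<sigma> * \<Delta>) \<le> real (card ?T)"
      by (simp add: sum_subtractf sum_distrib_left)
    have "real (card (F - Z)) \<le> 4 * real r"
      using card_F_le card_mono[OF finite_F, of "F - Z"] by simp
    then have FZ: "real (card (F - Z)) * (\<sigma> * \<Delta>) \<le> 4 * real r * (\<sigma> * \<Delta>)"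
      using \<sigma> \<Delta> by (intro mult_right_mono) auto
    have "(\<Sum>x\<in>F. real (card (J x))) = (\<Sum>x\<in>F - Z. real (card (J x))) + (\<Sum>x\<in>Z. real (card (J x)))"
      by (rule sum.subset_diff[OF Z(1) finite_F])
    moreover have "(\<Sum>x\<in>Z. real (card (J x))) \<le> (\<Sum>x\<in>Z. \<Delta>)" by (intro sum_mono card_J_le)
    moreover have "(\<Sum>x\<in>Z. \<Delta>) \<le> \<sigma> * real r * \<Delta>" using Z(2) \<Delta> by (simp add: mult_right_mono)
    ultimately have "(1 - 3 * \<sigma>) * (\<Delta> * real r) \<le> (\<Sum>x\<in>F - Z. real (card (J x)))"
      using sum_card_J_ge by (simp add: algebra_simps)
    then have "m * ((1 - 3 * \<sigma>) * (\<Delta> * real r)) \<le> m * (\<Sum>x\<in>F - Z. real (card (J x)))"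
      using m by (intro mult_left_mono) auto
    moreover have "m * (3 * \<sigma> * (\<Delta> * real r)) \<le> 1 * (3 * \<sigma> * (\<Delta> * real r))"
      using m \<sigma> \<Delta> by (intro mult_right_mono) auto
    ultimately show ?thesis using T_ge FZ T_le C_le by (simp add: algebra_simps)
  qed
  moreover have "(\<Sum>e\<in>E. w e) * (m + \<sigma>) * \<Delta> = real (card S)"
    using SE D(1) by (simp add: sum_w[OF finite_edges] Int_absorb1 mult.assoc flip: D_def)
  ultimately have W: "real r * (m - 13 * \<sigma>) \<le> (\<Sum>e\<in>E. w e) * (m + \<sigma>)"
    using \<Delta> by (smt (verit) mult_le_cancel_right)
  have W0: "0 \<le> (\<Sum>e\<in>E. w e)" using D(1) by (intro sum_nonneg) (simp add: w_def)
  have "\<gamma>\<^sup>2 * \<sigma> \<le> 1 * \<sigma>" using \<gamma> \<sigma> by (intro mult_right_mono power_le_one) auto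
  then have "1 - \<sigma> \<le> 1 - \<gamma>\<^sup>2 * \<sigma> / 2" using \<sigma>(1) by linarith
  then have "(1 - \<sigma>) * (\<Sum>e\<in>E. w e) \<le> (1 - \<gamma>\<^sup>2 * \<sigma> / 2) * (\<Sum>e\<in>E. w e)"
    using W0 by (rule mult_right_mono)
  then have cM: "(1 - \<sigma>) * (\<Sum>e\<in>E. w e) \<le> real (card M)" using M(3) by linarith
  \<comment> \<open>It suffices that \<open>28 * m \<ge> 14\<close>, which
    \<open>m \<ge> 8 / 9\<close> gives with room to spare.\<close>
  have "(1 - 29 * \<sigma>) * (m + \<sigma>) \<le> (1 - \<sigma>) * (m - 13 * \<sigma>)"
  proof -
    have "(1 - \<sigma>) * (m - 13 * \<sigma>) - (1 - 29 * \<sigma>) * (m + \<sigma>) = \<sigma> * (28 * m - 14 + 42 * \<sigma>)"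
      by (simp add: algebra_simps)
    moreover have "0 \<le> \<sigma> * (28 * m - 14 + 42 * \<sigma>)" using m \<sigma> by simp
    ultimately show ?thesis by linarith
  qed
  then have "real r * ((1 - 29 * \<sigma>) * (m + \<sigma>)) \<le> real r * ((1 - \<sigma>) * (m - 13 * \<sigma>))"
    by (rule mult_left_mono) simp
  also have "\<dots> = (1 - \<sigma>) * (real r * (m - 13 * \<sigma>))" by simp
  also have "\<dots> \<le> (1 - \<sigma>) * ((\<Sum>e\<in>E. w e) * (m + \<sigma>))"
    using W \<sigma> by (intro mult_left_mono) auto
  also have "\<dots> = (1 - \<sigma>) * (\<Sum>e\<in>E. w e) * (m + \<sigma>)" by simp
  also have "\<dots> \<le> real (card M) * (m + \<sigma>)" using cM m \<sigma> by (intro mult_right_mono) auto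
  finally have "((1 - 29 * \<sigma>) * real r) * (m + \<sigma>) \<le> real (card M) * (m + \<sigma>)" by (simp add: mult_ac)
  moreover have "0 < m + \<sigma>" using m \<sigma> by linarith
  ultimately have "(1 - 29 * \<sigma>) * real r \<le> real (card M)" by (simp only: mult_le_cancel_right_pos)
  moreover have "M \<subseteq> (\<Union>x\<in>F - Z. available R x)" "\<Union>(V ` M) \<inter> Y = {}" using MS by (auto simp: S_def)
  ultimately show thesis using that M(1) by blast
qed

end

section \<open>Assembling the matching in the tight case\<close>

context tight_hypergraph
begin

text \<open>Three matchings are joined: \<open>M0\<close> settles the deficit and \<open>Z\<close>,
  \<open>M1\<close> is the nibble outside the reserve, and \<open>N\<close> matches as many further
  full vertices as are missing, with their other vertices inside the reserve.\<close>

lemma exists_hmatching_of_tight: "\<exists>M. hmatching M \<and> r \<le> card M"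
proof -
  have sr: "\<sigma> * real r \<le> \<sigma> * \<Delta>" using r_le \<sigma> by (intro mult_left_mono) auto
  have t: "0 < \<sigma> * \<Delta>" using \<sigma> \<Delta> by simp
  obtain R Z where Z: "Z \<subseteq> F" "(\<sigma> * \<Delta>)\<^sup>2 * real (card Z) \<le> 2 * \<Delta> * real (card F)"
    and R: "\<forall>x\<in>F - Z. (\<gamma> / 2)\<^sup>2 * real (card (J x)) - \<sigma> * \<Delta> \<le> real (card {e \<in> J x. V e - {x} \<subseteq> R}) \<and>
      \<bar>real (card {e \<in> J x. (V e - {x}) \<inter> R = {}}) - (1 - \<gamma> / 2)\<^sup>2 * real (card (J x))\<bar> \<le> \<sigma> * \<Delta>"
    using exists_reserve[OF finite_F, of J \<Delta> "\<gamma> / 2" "\<sigma> * \<Delta>"] J_subset card_J_le \<gamma> t by auto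
  have "real (card Z) \<le> \<sigma> * real r"
  proof -
    \<comment> \<open>With \<open>card F \<le> 4 * r\<close> the Markov bound becomes
      \<open>8 * \<Delta> * r\<close>, and the lower bound on \<open>\<Delta>\<close> turns this
      into \<open>(\<sigma> * \<Delta>)\<^sup>2 * (\<sigma> * r)\<close>.\<close>
    have "8 \<le> \<sigma> ^ 3 * \<Delta>" using \<Delta>_ge \<sigma>(1) by (simp add: pos_divide_le_eq mult.commute)
    then have "8 * real r \<le> \<sigma> ^ 3 * \<Delta> * real r" by (intro mult_right_mono) auto
    then have "2 * \<Delta> * real (card F) \<le> \<Delta> * (\<sigma> ^ 3 * \<Delta> * real r)"
      using card_F_le \<Delta> mult_left_mono[of "2 * real (card F)" "\<sigma> ^ 3 * \<Delta> * real r" \<Delta>] by (simp add: mult_ac)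
    also have "\<dots> = (\<sigma> * \<Delta>)\<^sup>2 * (\<sigma> * real r)" by (simp add: power2_eq_square power3_eq_cube)
    finally have "(\<sigma> * \<Delta>)\<^sup>2 * real (card Z) \<le> (\<sigma> * \<Delta>)\<^sup>2 * (\<sigma> * real r)" using Z(2) by linarith
    moreover have "0 < (\<sigma> * \<Delta>)\<^sup>2" using t by (rule zero_less_power)
    ultimately show ?thesis by (simp only: mult_le_cancel_left_pos)
  qed
  note Z = Z(1) this
  obtain M0 where M0: "hmatching M0" "card M0 = (r - card F) + card Z" "\<Union>(V ` M0) \<inter> F = Z"
    "real (card M0) \<le> 2 * \<sigma> * real r"
    using exists_initial_hmatching[OF Z] by blast
  let ?Y = "\<Union>(V ` M0)"
  have Y: "finite ?Y" "real (card ?Y) \<le> 6 * \<sigma> * real r"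
    using finite_Union_hmatching[OF M0(1)] card_Union_hmatching[OF M0(1)] M0(4) by auto
  obtain M1 where M1: "hmatching M1" "(1 - 29 * \<sigma>) * real r \<le> real (card M1)"
    "M1 \<subseteq> (\<Union>x\<in>F - Z. available R x)" "\<Union>(V ` M1) \<inter> ?Y = {}"
    using exists_main_hmatching[OF Z Y(1) M0(3) Y(2), of R] R unfolding available_def by blast
  have M1_edge: "\<exists>x\<in>F - Z. V e \<inter> F = {x} \<and> (V e - {x}) \<inter> R = {}" if "e \<in> M1" for e
    using that M1(3) by (auto simp: available_def J_def)
  define s where "s = r - (card M0 + card M1)"
  have fin: "finite M0" "finite M1" using finite_hmatching M0(1) M1(1) by auto
  \<comment> \<open>Enough full vertices remain: each edge of \<open>M1\<close> uses exactly one,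
    and \<open>card M0\<close> already includes both \<open>r - card F\<close> and
    \<open>card Z\<close>.\<close>
  have "s \<le> card (F - Z - \<Union>(V ` M1))"
  proof -
    have "F \<inter> \<Union>(V ` M1) = (\<Union>e\<in>M1. V e \<inter> F)" by blast
    moreover have "card (\<Union>e\<in>M1. V e \<inter> F) \<le> (\<Sum>e\<in>M1. card (V e \<inter> F))" by (rule card_UN_le[OF fin(2)])
    moreover have "(\<Sum>e\<in>M1. card (V e \<inter> F)) = (\<Sum>e\<in>M1. 1)"
      by (rule sum.cong[OF refl]) (use M1_edge in fastforce)
    ultimately have "card (F \<inter> \<Union>(V ` M1)) \<le> card M1" by simp
    moreover have "card F \<le> card (F - Z - \<Union>(V ` M1)) + card Z + card (F \<inter> \<Union>(V ` M1))"
    proof -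
      have "F \<subseteq> (F - Z - \<Union>(V ` M1)) \<union> Z \<union> (F \<inter> \<Union>(V ` M1))" by blast
      then have "card F \<le> card ((F - Z - \<Union>(V ` M1)) \<union> Z \<union> (F \<inter> \<Union>(V ` M1)))"
        using finite_F finite_subset[OF Z(1)] by (intro card_mono) auto
      also have "\<dots> \<le> card (F - Z - \<Union>(V ` M1)) + card Z + card (F \<inter> \<Union>(V ` M1))"
        by (meson card_Un_le add_right_mono order_trans)
      finally show ?thesis .
    qed
    ultimately show ?thesis unfolding s_def M0(2) by linarith
  qed
  then obtain X where X: "X \<subseteq> F - Z - \<Union>(V ` M1)" "card X = s" "finite X"
    using obtain_subset_with_card_n by metis
  define J' where "J' x = {e \<in> J x. V e - {x} \<subseteq> R}" for x
  \<comment> \<open>Only \<open>M0\<close> has to be dodged here; disjointness from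
    \<open>M1\<close> will follow from the reserve.\<close>
  have "\<exists>N. hmatching (M0 \<union> N) \<and> M0 \<inter> N = {} \<and> card N = card X \<and> X \<subseteq> \<Union>(V ` N) \<and> N \<subseteq> (\<Union>x\<in>X. J' x)"
  proof (rule extend_hmatching[OF X(3) M0(1)])
    show "X \<inter> ?Y = {}" using X(1) M0(3) by blast
    show "V e \<inter> X \<subseteq> {x}" if "e \<in> J' x" for e x using that X(1) by (auto simp: J'_def J_def)
    show "J' x \<subseteq> inc x \<and> 3 * (card M0 + card X) \<le> card (J' x)" if "x \<in> X" for x
    proof
      show "J' x \<subseteq> inc x" using J_subset by (auto simp: J'_def)
      have x: "x \<in> F - Z" using X(1) that by blast
      have "real s \<le> 29 * \<sigma> * real r"
      proof (cases "card M0 + card M1 \<le> r")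
        case True
        then show ?thesis using M1(2) by (simp add: s_def of_nat_diff algebra_simps)
      qed (use \<sigma> in \<open>simp add: s_def\<close>)
      then have "real s \<le> 29 * (\<sigma> * \<Delta>)" "real (card M0) \<le> 2 * (\<sigma> * \<Delta>)"
        using M0(4) sr unfolding mult.assoc by auto
      \<comment> \<open>The need is \<open>93 = 3 * (2 + 29)\<close> units of
        \<open>\<sigma> * \<Delta>\<close>; the reserve offers 100, less 1 for its
        deviation.\<close>
      then have "3 * (real (card M0) + real s) \<le> 93 * (\<sigma> * \<Delta>)" by argo
      also have "\<dots> \<le> 99 * (\<sigma> * \<Delta>)" using t by argo
      also have "\<dots> = (\<gamma> / 2)\<^sup>2 * (\<gamma> * \<Delta>) - \<sigma> * \<Delta>"
      proof -
        have "(\<gamma> / 2)\<^sup>2 * (\<gamma> * \<Delta>) = \<gamma> ^ 3 / 4 * \<Delta>" by (simp add: power2_eq_square power3_eq_cube)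
        also have "\<dots> = 100 * (\<sigma> * \<Delta>)" unfolding \<sigma>(4) by simp
        finally show ?thesis by argo
      qed
      also have "\<dots> \<le> (\<gamma> / 2)\<^sup>2 * real (card (J x)) - \<sigma> * \<Delta>"
        using J_ge x by (intro diff_right_mono mult_left_mono) auto
      also have "\<dots> \<le> real (card (J' x))" using R x by (simp add: J'_def)
      finally have "real (3 * (card M0 + card X)) \<le> real (card (J' x))" using X(2) by simp
      then show "3 * (card M0 + card X) \<le> card (J' x)" by (simp only: of_nat_le_iff)
    qed
  qed
  then obtain N where N: "hmatching (M0 \<union> N)" "M0 \<inter> N = {}" "card N = s" "N \<subseteq> (\<Union>x\<in>X. J' x)"
    using X(2) by blast
  have disj: "V e \<inter> V f = {}" if e: "e \<in> M0 \<union> N" and f: "f \<in> M1" for e f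
  proof (cases "e \<in> M0")
    case True
    then show ?thesis using M1(4) f by blast
  next
    case False
    then obtain y where y: "y \<in> X" "e \<in> J' y" using e N(4) by blast
    obtain x where x: "V f \<inter> F = {x}" "(V f - {x}) \<inter> R = {}" using M1_edge[OF f] by blast
    have yf: "y \<notin> V f" using y(1) X(1) f by blast
    have ye: "V e - {y} \<subseteq> R" "V e \<inter> F = {y}" using y(2) by (auto simp: J'_def J_def)
    \<comment> \<open>A common vertex is not \<open>y\<close>, which \<open>M1\<close> leaves
      uncovered, so it lies in \<open>R\<close> and is not full. But \<open>f\<close> can meet
      \<open>R\<close> only in its full vertex.\<close>
    show ?thesis
    proof (rule equals0I)
      fix u assume "u \<in> V e \<inter> V f"
      then have u: "u \<in> V e" "u \<in> V f" by auto
      then have "u \<noteq> y" using yf by blast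
      then have "u \<in> R" "u \<notin> F" using u(1) ye by blast+
      then have "u = x" using u(2) x(2) by blast
      then show False using x(1) \<open>u \<notin> F\<close> by blast
    qed
  qed
  note un = hmatching_Un[OF N(1) M1(1) disj]
  have finN: "finite N" using finite_hmatching[OF N(1)] by simp
  have "card (M0 \<union> N \<union> M1) = card M0 + s + card M1"
    using un(2) N(2,3) fin finN by (simp add: card_Un_disjoint)
  then have "r \<le> card (M0 \<union> N \<union> M1)" by (simp add: s_def)
  then show ?thesis using un(1) by blast
qed

end

lemma (in full_degree_hypergraph) exists_hmatching: "\<exists>M. hmatching M \<and> r \<le> card M"
proof (cases "(1 + \<gamma>\<^sup>2 * \<sigma>) * (\<Delta> * real r) \<le> real (card E) + \<gamma> * real (card E0) + \<gamma>\<^sup>2 * real (card E2)")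
  case True
  then show ?thesis by (rule exists_hmatching_of_slack)
next
  case False
  then interpret tight_hypergraph E V \<gamma> \<Delta> \<sigma> r F J
    by unfold_locales (auto simp: \<sigma>_def F_def J_def)
  show ?thesis by (rule exists_hmatching_of_tight)
qed

subsection \<open>Rainbow matchings as hypergraph matchings\<close>

definition colored_edge :: "('v set \<Rightarrow> 'c) \<Rightarrow> 'v set \<Rightarrow> ('v + 'c) set" where
  "colored_edge c e = insert (Inr (c e)) (Inl ` e)"

lemma colored_edge_simps [simp]:
  "Inl v \<in> colored_edge c e \<longleftrightarrow> v \<in> e" "Inr x \<in> colored_edge c e \<longleftrightarrow> x = c e"
  by (auto simp: colored_edge_def)

text \<open>Distinct edges of a simple graph share at most one endpoint, and if they share one,
  properness forbids a common colour as well.\<close>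

lemma linear_hypergraph_colored_edge:
  fixes c :: "'v set \<Rightarrow> 'c"
  assumes "simple_graph W E" "proper_edge_coloring E C c"
  shows "linear_hypergraph E (colored_edge c)"
proof
  have fin: "finite e" "card e = 2" if "e \<in> E" for e
    using assms(1) that by (auto simp: simple_graph_def intro: finite_subset)
  have "E \<subseteq> Pow W" "finite W" using assms(1) by (auto simp: simple_graph_def)
  then show "finite E" using finite_subset by blast
  show "card (colored_edge c e) = 3" if "e \<in> E" for e
    using fin[OF that] by (simp add: colored_edge_def card_insert_if card_image image_iff)
  show "card (colored_edge c e \<inter> colored_edge c f) \<le> 1" if ef: "e \<in> E" "f \<in> E" "e \<noteq> f" for e f
  proof (cases "e \<inter> f = {}")
    case True
    then have "colored_edge c e \<inter> colored_edge c f \<subseteq> {Inr (c e)}" by (auto simp: colored_edge_def)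
    then have "card (colored_edge c e \<inter> colored_edge c f) \<le> card {Inr (c e) :: 'v + 'c}"
      by (intro card_mono) simp_all
    then show ?thesis by simp
  next
    case False
    then have "c e \<noteq> c f" using assms(2) ef by (auto simp: proper_edge_coloring_def)
    then have "colored_edge c e \<inter> colored_edge c f = Inl ` (e \<inter> f)" by (auto simp: colored_edge_def)
    then have "card (colored_edge c e \<inter> colored_edge c f) = card (e \<inter> f)" by (simp add: card_image)
    moreover have "card (e \<inter> f) < 2"
    proof (rule ccontr)
      assume "\<not> ?thesis"
      then have "e \<inter> f = e" "e \<inter> f = f" 
        using card_seteq[OF fin(1)[OF ef(1)], of "e \<inter> f"] card_seteq[OF fin(1)[OF ef(2)], of "e \<inter> f"]
          fin(2) ef(1,2) by auto
      then show False using ef(3) by simp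
    qed
    ultimately show ?thesis by simp
  qed
qed

text \<open>Stars at vertices on the same side of a bipartite graph are disjoint. Bipartiteness
  enters here and in the next lemma.\<close>

lemma card_full_part_le:
  fixes t :: real
  assumes H: "linear_hypergraph E (colored_edge c)" and A: "finite A" "A \<subseteq> S"
    and parts: "S \<inter> T = {}" "\<And>e. e \<in> E \<Longrightarrow> \<exists>a\<in>S. \<exists>b\<in>T. e = {a, b}"
    and full: "\<And>a. a \<in> A \<Longrightarrow> t \<le> real (card (linear_hypergraph.inc E (colored_edge c) (Inl a)))"
  shows "real (card A) * t \<le> real (card E)"
proof -
  interpret linear_hypergraph E "colored_edge c" by (rule H)
  have "real (card A) * t \<le> (\<Sum>a\<in>A. real (card (inc (Inl a))))"
    using sum_mono[of A "\<lambda>_. t", OF full] by simp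
  also have "\<dots> = real (card (\<Union>a\<in>A. inc (Inl a)))"
  proof -
    have "inc (Inl a) \<inter> inc (Inl b) = {}" if "a \<in> A" "b \<in> A" "a \<noteq> b" for a b
      using that A(2) parts by (auto simp: inc_def) blast
    then show ?thesis using A(1) by (simp add: card_UN_disjoint)
  qed
  also have "\<dots> \<le> real (card E)"
    using inc_subset finite_edges by (intro of_nat_mono card_mono) auto
  finally show ?thesis .
qed

text \<open>Colours are never full, so an edge at \<open>a\<close> with a second full vertex has a
  full endpoint on the other side and is determined by it.\<close>

lemma card_inc_le_single_full:
  fixes F :: "('v + 'c) set"
  assumes H: "linear_hypergraph E (colored_edge c)"
    and parts: "S \<inter> T = {}" "\<And>e. e \<in> E \<Longrightarrow> \<exists>a\<in>S. \<exists>b\<in>T. e = {a, b}"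
    and F: "\<And>x. Inr x \<notin> F" "finite {b \<in> T. Inl b \<in> F}" and a: "a \<in> S" "Inl a \<in> F"
  shows "card (linear_hypergraph.inc E (colored_edge c) (Inl a))
    \<le> card {e \<in> linear_hypergraph.inc E (colored_edge c) (Inl a). colored_edge c e \<inter> F = {Inl a}}
      + card {b \<in> T. Inl b \<in> F}"
proof -
  interpret linear_hypergraph E "colored_edge c" by (rule H)
  let ?J = "{e \<in> inc (Inl a). colored_edge c e \<inter> F = {Inl a}}"
  have "inc (Inl a) \<subseteq> ?J \<union> (\<lambda>b. {a, b}) ` {b \<in> T. Inl b \<in> F}"
  proof
    fix e assume e: "e \<in> inc (Inl a)"
    then have "e \<in> E" "a \<in> e" by (auto simp: inc_def)
    then obtain b where b: "b \<in> T" "e = {a, b}" using parts a(1) by blast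
    then have "colored_edge c e \<inter> F = insert (Inl a) ({Inl b} \<inter> F)"
      using F(1) a(2) by (auto simp: colored_edge_def)
    then show "e \<in> ?J \<union> (\<lambda>b. {a, b}) ` {b \<in> T. Inl b \<in> F}" using b e by (cases "Inl b \<in> F") auto
  qed
  moreover have "finite ?J" by simp
  ultimately have "card (inc (Inl a)) \<le> card (?J \<union> (\<lambda>b. {a, b}) ` {b \<in> T. Inl b \<in> F})"
    using F(2) by (intro card_mono) auto
  also have "\<dots> \<le> card ?J + card ((\<lambda>b. {a, b}) ` {b \<in> T. Inl b \<in> F})" by (rule card_Un_le)
  also have "\<dots> \<le> card ?J + card {b \<in> T. Inl b \<in> F}" using F(2) by (simp add: card_image_le)
  finally show ?thesis .
qed

lemma rainbow_matching_of_hmatching: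
  assumes H: "linear_hypergraph E (colored_edge c)"
    and M: "linear_hypergraph.hmatching E (colored_edge c) M" "r \<le> card M"
  shows "\<exists>N. matching E N \<and> rainbow c N \<and> card N = r"
proof -
  interpret linear_hypergraph E "colored_edge c" by (rule H)
  obtain N where N: "N \<subseteq> M" "card N = r" using obtain_subset_with_card_n[OF M(2)] by blast
  have disj: "e \<inter> f = {} \<and> c e \<noteq> c f" if "e \<in> N" "f \<in> N" "e \<noteq> f" for e f
  proof -
    have "colored_edge c e \<inter> colored_edge c f = {}" 
      using M(1) N(1) that unfolding hmatching_def by (meson subsetD)
    then show ?thesis by (auto simp: colored_edge_def)
  qed
  have "N \<subseteq> E" using M(1) N(1) by (auto simp: hmatching_def)
  then show ?thesis
    using disj N(2) by (intro exI[of _ N]) (auto simp: matching_def rainbow_def pairwise_def disjnt_def inj_on_def)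
qed

theorem theorem2p18:
  fixes \<epsilon> :: real
  assumes "\<epsilon> > 0"
  shows "\<exists>q0::nat. \<forall>q\<ge>q0.
    \<forall>(V :: 'v set) (E :: 'v set set) (C :: 'c set) (c :: 'v set \<Rightarrow> 'c) (r :: nat).
      simple_graph V E \<and> bipartite V E \<and>
      finite C \<and> real (card C) \<le> (1 + \<epsilon>) * real q \<and> proper_edge_coloring E C c \<and>
      r \<le> q \<and> real (card E) \<ge> (1 + \<epsilon>) * real q * real r \<and>
      (\<forall>x\<in>C. card {e \<in> E. c e = x} \<le> q)
      \<longrightarrow> (\<exists>M. matching E M \<and> rainbow c M \<and> card M = r)"
proof -
  \<comment> \<open>The choice \<open>9 * \<gamma> \<le> \<epsilon>\<close> yields
    \<open>(1 + 9 * \<gamma>) * q \<le> \<Delta>\<close>, a margin that survives the factors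
    \<open>1 - \<gamma>\<close>, \<open>1 - 3 * \<gamma>\<close> and \<open>1 + \<gamma>\<close>
    needed later.\<close>
  define \<gamma> where "\<gamma> = min \<epsilon> 1 / 9"
  define \<sigma> where "\<sigma> = \<gamma> ^ 3 / 400"
  have \<gamma>: "0 < \<gamma>" "\<gamma> \<le> 1 / 9" "9 * \<gamma> \<le> \<epsilon>" using assms by (auto simp: \<gamma>_def)
  have \<sigma>: "0 < \<sigma>" "\<sigma> \<le> 1" using \<gamma> by (auto simp: \<sigma>_def power_le_one intro: order_trans[of _ 1])
  define \<delta> where "\<delta> = \<gamma>\<^sup>2 * \<sigma> / 2"
  have \<delta>: "0 < \<delta>" "\<delta> \<le> \<gamma> / 2"
  proof -
    show "0 < \<delta>" using \<gamma> \<sigma> by (simp add: \<delta>_def)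
    have "\<gamma> * (\<gamma> * \<sigma>) \<le> \<gamma> * 1" using \<gamma> \<sigma> by (intro mult_left_mono mult_le_one) auto
    then show "\<delta> \<le> \<gamma> / 2" by (simp add: \<delta>_def power2_eq_square mult.assoc)
  qed
  obtain D0 where D0: "\<And>(E :: 'v set set) (V :: 'v set \<Rightarrow> ('v + 'c) set) w D.
      linear_hypergraph E V \<Longrightarrow> D0 \<le> D \<Longrightarrow> linear_hypergraph.fractional E V w \<Longrightarrow> \<forall>e\<in>E. w e \<le> 1 / D \<Longrightarrow>
      \<exists>M. linear_hypergraph.hmatching E V M \<and> (\<forall>e\<in>M. 0 < w e) \<and> (1 - \<delta>) * (\<Sum>e\<in>E. w e) \<le> real (card M)"
    using fractional_to_matching[OF \<delta>(1), where 'e = "'v set" and 'x = "'v + 'c"] by blast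
  \<comment> \<open>The factor 2 is there because weights may reach \<open>2 / \<Delta>\<close>, so
    the nibble runs with \<open>D = \<Delta> / 2\<close>. The added 1 ensures
    \<open>\<Delta> > 0\<close>.\<close>
  define q0 where "q0 = nat \<lceil>max (2 * D0) (8 / \<sigma> ^ 3)\<rceil> + 1"
  show ?thesis
  proof (intro exI[of _ q0] allI impI)
    fix q :: nat and W :: "'v set" and E :: "'v set set" and C :: "'c set" and c :: "'v set \<Rightarrow> 'c" and r :: nat
    assume q: "q0 \<le> q" and G: "simple_graph W E \<and> bipartite W E \<and> finite C \<and>
      real (card C) \<le> (1 + \<epsilon>) * real q \<and> proper_edge_coloring E C c \<and> r \<le> q \<and>
      real (card E) \<ge> (1 + \<epsilon>) * real q * real r \<and> (\<forall>x\<in>C. card {e \<in> E. c e = x} \<le> q)"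
    define \<Delta> where "\<Delta> = (1 + \<epsilon>) * real q"
    have E_ge: "\<Delta> * real r \<le> real (card E)" and C_le: "real (card C) \<le> \<Delta>" using G by (auto simp: \<Delta>_def)
    have q_ge: "2 * D0 \<le> real q" "8 / \<sigma> ^ 3 \<le> real q" "1 \<le> real q"
      using q unfolding q0_def by linarith+
    have q_le: "(1 + 9 * \<gamma>) * real q \<le> \<Delta>"
      unfolding \<Delta>_def using \<gamma>(3) by (intro mult_right_mono) auto
    then have "real q \<le> \<Delta>" 
      using \<gamma>(1) mult_right_mono[of 1 "1 + 9 * \<gamma>" "real q"] by simp
    then have \<Delta>: "2 * D0 \<le> \<Delta>" "8 / \<sigma> ^ 3 \<le> \<Delta>" "1 \<le> \<Delta>" "real r \<le> \<Delta>" using q_ge G by auto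
    have H: "linear_hypergraph E (colored_edge c)"
      using G linear_hypergraph_colored_edge by blast
    interpret linear_hypergraph E "colored_edge c" by (rule H)
    have color_degree: "real (card (inc (Inr x))) \<le> real q" for x
    proof (cases "x \<in> C")
      case True
      have "inc (Inr x) = {e \<in> E. c e = x}" by (auto simp: inc_def)
      then show ?thesis using G True by simp
    next
      case False
      then have "inc (Inr x) = {}" using G by (auto simp: inc_def proper_edge_coloring_def)
      then show ?thesis by simp
    qed
    have degree: "real (card (inc x)) \<le> \<Delta>" for x
    proof (cases x)
      case (Inl v)
      have "proper_edge_coloring E C c" using G by simp
      then have "inj_on c (inc (Inl v))" "c ` inc (Inl v) \<subseteq> C"
        by (auto simp: inj_on_def inc_def proper_edge_coloring_def)
      then have "card (inc (Inl v)) \<le> card C" using G card_inj_on_le by blast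
      then show ?thesis using C_le Inl by simp
    next
      case (Inr y)
      then show ?thesis using color_degree[of y] \<open>real q \<le> \<Delta>\<close> by simp
    qed
    have nibble: "\<exists>M. hmatching M \<and> (\<forall>e\<in>M. 0 < w e) \<and> (1 - \<gamma>\<^sup>2 * \<sigma> / 2) * (\<Sum>e\<in>E. w e) \<le> real (card M)"
      if "fractional w" "\<forall>e\<in>E. w e \<le> 2 / \<Delta>" for w
      using D0[OF H, of "\<Delta> / 2" w] that \<Delta>(1) by (simp add: \<delta>_def)
    have "\<exists>M. hmatching M \<and> r \<le> card M"
    \<comment> \<open>With this many edges the uniform weight \<open>1 / \<Delta>\<close> already
      has size \<open>(1 + \<gamma>) * r\<close>. Otherwise the upper bound on \<open>card E\<close>
      limits the number of full vertices.\<close>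
    proof (cases "(1 + \<gamma>) * (\<Delta> * real r) \<le> real (card E)")
      case True
      have "fractional (\<lambda>_. 1 / \<Delta>)"
        using degree \<Delta>(3) by (auto simp: fractional_def)
      moreover have "\<forall>e\<in>E. 1 / \<Delta> \<le> 2 / \<Delta>" using \<Delta>(3) by (simp add: divide_right_mono)
      ultimately obtain M where M: "hmatching M" "(1 - \<delta>) * (real (card E) / \<Delta>) \<le> real (card M)"
        using nibble[of "\<lambda>_. 1 / \<Delta>"] by (auto simp: \<delta>_def)
      have "\<gamma> * \<gamma> \<le> \<gamma> * 1" using \<gamma> by (intro mult_left_mono) auto
      then have "1 \<le> (1 - \<gamma> / 2) * (1 + \<gamma>)" by (simp add: algebra_simps)
      also have "\<dots> \<le> (1 - \<delta>) * (1 + \<gamma>)" using \<delta> \<gamma> by (intro mult_right_mono) auto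
      finally have "1 * real r \<le> (1 - \<delta>) * (1 + \<gamma>) * real r" by (rule mult_right_mono) simp
      also have "\<dots> = (1 - \<delta>) * ((1 + \<gamma>) * real r)" by simp
      also have "\<dots> \<le> (1 - \<delta>) * (real (card E) / \<Delta>)"
        using True \<Delta>(3) \<delta> \<gamma> by (intro mult_left_mono) (auto simp: pos_le_divide_eq mult_ac)
      finally have "real r \<le> real (card M)" using M(2) by linarith
      then show ?thesis using M(1) by auto
    next
      case False
      define F where "F = {x. (1 - \<gamma>) * \<Delta> < real (card (inc x))}"
      have q_low: "(1 + \<gamma>) * real q \<le> (1 - \<gamma>) * ((1 - 3 * \<gamma>) * \<Delta>)"
      proof -
        have "\<gamma> * \<gamma> \<le> 1 / 9 * \<gamma>" using \<gamma> by (intro mult_right_mono) auto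
        then have "0 \<le> \<gamma> * (4 - 33 * \<gamma> + 27 * (\<gamma> * \<gamma>))" using \<gamma> by (intro mult_nonneg_nonneg) auto
        then have "1 + \<gamma> \<le> (1 - \<gamma>) * (1 - 3 * \<gamma>) * (1 + 9 * \<gamma>)" by (simp add: algebra_simps)
        then have "(1 + \<gamma>) * real q \<le> (1 - \<gamma>) * (1 - 3 * \<gamma>) * (1 + 9 * \<gamma>) * real q"
          by (rule mult_right_mono) simp
        also have "\<dots> = (1 - \<gamma>) * (1 - 3 * \<gamma>) * ((1 + 9 * \<gamma>) * real q)" by simp
        also have "\<dots> \<le> (1 - \<gamma>) * (1 - 3 * \<gamma>) * \<Delta>"
          using q_le \<gamma> by (intro mult_left_mono) auto
        finally show ?thesis by simp
      qed
      have Inr_F: "Inr x \<notin> F" for x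
      proof -
        have "real q \<le> (1 + \<gamma>) * real q" using \<gamma>(1) by (simp add: distrib_right)
        also note q_low
        also have "(1 - \<gamma>) * ((1 - 3 * \<gamma>) * \<Delta>) \<le> (1 - \<gamma>) * (1 * \<Delta>)"
          using \<gamma> \<Delta>(3) by (intro mult_left_mono mult_right_mono) auto
        finally show ?thesis using color_degree[of x] by (simp add: F_def)
      qed
      have "bipartite W E" using G by simp
      then obtain A B where AB: "A \<union> B = W" "A \<inter> B = {}" "\<And>e. e \<in> E \<Longrightarrow> \<exists>a\<in>A. \<exists>b\<in>B. e = {a, b}"
        unfolding bipartite_def by metis
      have "finite W" using G by (auto simp: simple_graph_def)
      then have fin: "finite A" "finite B" using AB(1) by (auto intro: finite_subset)
      \<comment> \<open>Since \<open>r \<le> q\<close>, each side has at most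
        \<open>(1 - 3 * \<gamma>) * \<Delta>\<close> full vertices. A full vertex has more than
        \<open>(1 - \<gamma>) * \<Delta>\<close> edges, so over
        \<open>2 * \<gamma> * \<Delta>\<close> of them lead to a vertex that is not full.\<close>
      have J_part: "\<gamma> * \<Delta> \<le> real (card {e \<in> inc (Inl a). colored_edge c e \<inter> F = {Inl a}})"
        if ST: "finite T" "S \<inter> T = {}" "\<And>e. e \<in> E \<Longrightarrow> \<exists>a\<in>S. \<exists>b\<in>T. e = {a, b}"
          and a: "a \<in> S" "Inl a \<in> F" for S T a
      proof -
        let ?T = "{b \<in> T. Inl b \<in> F}"
        have "real (card ?T) * ((1 - \<gamma>) * \<Delta>) \<le> real (card E)"
        proof (rule card_full_part_le[OF H, of _ T S])
          show "T \<inter> S = {}" using ST(2) by blast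
          show "\<exists>b\<in>T. \<exists>a\<in>S. e = {b, a}" if "e \<in> E" for e
            using ST(3)[OF that] by (metis insert_commute)
        qed (use ST(1) in \<open>auto simp: F_def\<close>)
        also have "\<dots> \<le> (1 + \<gamma>) * (\<Delta> * real q)"
        proof -
          have "(1 + \<gamma>) * (\<Delta> * real r) \<le> (1 + \<gamma>) * (\<Delta> * real q)"
            using G \<gamma> \<Delta>(3) by (intro mult_left_mono) auto
          then show ?thesis using False by linarith
        qed
        also have "\<dots> = (1 + \<gamma>) * real q * \<Delta>" by simp
        also have "\<dots> \<le> (1 - \<gamma>) * ((1 - 3 * \<gamma>) * \<Delta>) * \<Delta>"
          using q_low \<Delta>(3) by (intro mult_right_mono) auto
        also have "\<dots> = (1 - 3 * \<gamma>) * \<Delta> * ((1 - \<gamma>) * \<Delta>)" by simp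
        finally have "real (card ?T) \<le> (1 - 3 * \<gamma>) * \<Delta>"
          using \<gamma> \<Delta>(3) by (simp only: mult_le_cancel_right_pos mult_pos_pos diff_gt_0_iff_gt)
        moreover have "(1 - \<gamma>) * \<Delta> < real (card (inc (Inl a)))" using a(2) by (simp add: F_def)
        moreover have "card (inc (Inl a)) \<le> card {e \<in> inc (Inl a). colored_edge c e \<inter> F = {Inl a}} + card ?T"
          by (rule card_inc_le_single_full[OF H ST(2,3) Inr_F _ a]) (use ST(1) in auto)
        moreover have "0 < \<gamma> * \<Delta>" using \<gamma> \<Delta>(3) by simp
        ultimately show ?thesis by (simp add: left_diff_distrib)
      qed
      have J_ge: "\<gamma> * \<Delta> \<le> real (card {e \<in> inc x. colored_edge c e \<inter> F = {x}})" if xF: "x \<in> F" for x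
      proof -
        obtain v where v: "x = Inl v" using xF Inr_F by (cases x) auto
        have "0 < (1 - \<gamma>) * \<Delta>" using \<gamma> \<Delta>(3) by simp
        then have "inc x \<noteq> {}" using xF by (auto simp: F_def)
        then obtain e where "e \<in> E" "v \<in> e" using v by (auto simp: inc_def)
        then have "v \<in> A \<or> v \<in> B" using AB(3) by blast
        then show ?thesis
        proof
          assume "v \<in> A"
          then show ?thesis using J_part[of B A v] fin AB xF v by blast
        next
          assume "v \<in> B"
          moreover have "\<exists>b\<in>B. \<exists>a\<in>A. e = {b, a}" if "e \<in> E" for e
            using AB(3)[OF that] by (metis insert_commute)
          moreover have "B \<inter> A = {}" using AB(2) by blast
          ultimately show ?thesis using J_part[of A B v] fin xF v by blast
        qed
      qed
      interpret full_degree_hypergraph E "colored_edge c" \<gamma> \<Delta> \<sigma> r F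
          "\<lambda>x. {e \<in> inc x. colored_edge c e \<inter> F = {x}}"
        by unfold_locales (use \<gamma> \<Delta> degree E_ge J_ge nibble in \<open>auto simp: \<sigma>_def F_def\<close>)
      show ?thesis by (rule exists_hmatching)
    qed
    then show "\<exists>M. matching E M \<and> rainbow c M \<and> card M = r"
      using rainbow_matching_of_hmatching[OF H] by blast
  qed
qed

end
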